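(* In the setting described in the context (with $\xi$ an arbitrary $\mathbb{R}^d$-valued Lévy process independent of $Y$, on which nothing further is assumed), assume that there exists $\delta>0$ such that \[ \int_0^\delta \mathbb{E}\, T_s^{-1/2}\,ds < \infty, \] and that $b \in C_b(\mathbb{R}^d;\mathbb{R}^d)$. Then $P^X_t$ is strong Feller for every $t>0$.
   Context: $W$ is a standard $\mathbb{R}^d$-valued Wiener process (identity covariance). A subordinator is an increasing Lévy process $T:\mathbb{R}_+\to\mathbb{R}_+$ with $T_0=0$ and $T_t>0$ for $t>0$; $T$ is independent of $W$, and $Y_t := W_{T_t}$. $\xi$ is an $\mathbb{R}^d$-valued Lévy process independent of $Y$, and $Z := Y+\xi$. Standing assumption: for each $x\in\mathbb{R}^d$ the SDE $dX_t=b(X_t)\,dt+dZ_t$, $X_0=x$, has a Markovian weak solution $X^x$, and the transition semigroup $P^X_t f(x) := \mathbb{E} f(X^x_t)$, $f\in\mathscr{B}_b(\mathbb{R}^d)$, is Feller for all $t\geq 0$, i.e. $P^X_t$ maps $C_b(\mathbb{R}^d)$ into $C_b(\mathbb{R}^d)$. $\mathscr{B}_b(\mathbb{R}^d)$ denotes bounded Borel functions, $C_b(\mathbb{R}^d)$ bounded continuous functions. A sub-Markovian operator $A$ on $\mathscr{B}_b(\mathbb{R}^d)$ is strong Feller if $A(\mathscr{B}_b(\mathbb{R}^d))\subseteq C_b(\mathbb{R}^d)$. *)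

theory Defs
  imports "HOL-Probability.Probability"
begin

text \<open>Processes are indexed by real time; only times t \<ge> 0 matter.
  The state space R^d is an arbitrary Euclidean space 'a.\<close>

definition process_law :: "'w measure \<Rightarrow> (real \<Rightarrow> 'w \<Rightarrow> 'a::topological_space) \<Rightarrow> (real \<Rightarrow> 'a) measure" where
  "process_law M X = distr M (PiM {0..} (\<lambda>_. borel)) (\<lambda>\<omega>. restrict (\<lambda>t. X t \<omega>) {0..})"

definition indep_processes ::
  "'w measure \<Rightarrow> (real \<Rightarrow> 'w \<Rightarrow> 'a::topological_space) \<Rightarrow> (real \<Rightarrow> 'w \<Rightarrow> 'b::topological_space) \<Rightarrow> bool" where
  "indep_processes M X Y \<longleftrightarrow>
     (\<forall>t\<ge>0. X t \<in> borel_measurable M) \<and> (\<forall>t\<ge>0. Y t \<in> borel_measurable M)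
     \<and> prob_space.indep_set M
         (sigma_sets (space M) {X t -` A \<inter> space M | t A. 0 \<le> t \<and> A \<in> sets borel})
         (sigma_sets (space M) {Y t -` A \<inter> space M | t A. 0 \<le> t \<and> A \<in> sets borel})"

definition cadlag :: "(real \<Rightarrow> 'a::topological_space) \<Rightarrow> bool" where
  "cadlag g \<longleftrightarrow> (\<forall>t\<ge>0. continuous (at_right t) g \<and> (t > 0 \<longrightarrow> (\<exists>l. (g \<longlongrightarrow> l) (at_left t))))"

definition levy_process :: "'w measure \<Rightarrow> (real \<Rightarrow> 'w \<Rightarrow> 'a::euclidean_space) \<Rightarrow> bool" where
  "levy_process M X \<longleftrightarrow> prob_space M
     \<and> (\<forall>t\<ge>0. X t \<in> borel_measurable M)
     \<and> (AE \<omega> in M. X 0 \<omega> = 0)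
     \<and> (AE \<omega> in M. cadlag (\<lambda>t. X t \<omega>))
     \<and> (\<forall>(n::nat) (ts::nat \<Rightarrow> real). 0 \<le> ts 0 \<and> (\<forall>i<n. ts i < ts (Suc i)) \<longrightarrow>
          prob_space.indep_vars M (\<lambda>_. borel) (\<lambda>i \<omega>. X (ts (Suc i)) \<omega> - X (ts i) \<omega>) {..<n})
     \<and> (\<forall>s t. 0 \<le> s \<longrightarrow> 0 \<le> t \<longrightarrow>
          distr M borel (\<lambda>\<omega>. X (s + t) \<omega> - X s \<omega>) = distr M borel (X t))"

definition wiener_process :: "'w measure \<Rightarrow> (real \<Rightarrow> 'w \<Rightarrow> 'a::euclidean_space) \<Rightarrow> bool" where
  "wiener_process M W \<longleftrightarrow> levy_process M W
     \<and> (AE \<omega> in M. continuous_on UNIV (\<lambda>t. W t \<omega>))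
     \<and> (\<forall>t>0. distr M borel (W t) =
          density lborel (\<lambda>x. ennreal ((2 * pi * t) powr (- real DIM('a) / 2)
                                     * exp (- (norm x)\<^sup>2 / (2 * t)))))"

definition subordinator :: "'w measure \<Rightarrow> (real \<Rightarrow> 'w \<Rightarrow> real) \<Rightarrow> bool" where
  "subordinator M T \<longleftrightarrow> levy_process M T
     \<and> (AE \<omega> in M. mono_on {0..} (\<lambda>t. T t \<omega>) \<and> T 0 \<omega> = 0 \<and> (\<forall>t>0. T t \<omega> > 0))"

definition weak_solution ::
  "('a::euclidean_space \<Rightarrow> 'a) \<Rightarrow> 'v measure \<Rightarrow> (real \<Rightarrow> 'v \<Rightarrow> 'a) \<Rightarrow> 'a
     \<Rightarrow> 'w measure \<Rightarrow> (real \<Rightarrow> 'w \<Rightarrow> 'a) \<Rightarrow> (real \<Rightarrow> 'w \<Rightarrow> 'a) \<Rightarrow> bool" where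
  "weak_solution b N Z x \<Omega> X Z' \<longleftrightarrow> prob_space \<Omega>
     \<and> (\<forall>t\<ge>0. X t \<in> borel_measurable \<Omega>) \<and> (\<forall>t\<ge>0. Z' t \<in> borel_measurable \<Omega>)
     \<and> process_law \<Omega> Z' = process_law N Z
     \<and> (AE \<omega> in \<Omega>. \<forall>t\<ge>0. set_integrable lborel {0..t} (\<lambda>s. b (X s \<omega>))
                       \<and> X t \<omega> = x + (LINT s:{0..t}|lborel. b (X s \<omega>)) + Z' t \<omega>)"

definition transition ::
  "('a \<Rightarrow> 'w measure) \<Rightarrow> ('a \<Rightarrow> real \<Rightarrow> 'w \<Rightarrow> 'a) \<Rightarrow> real \<Rightarrow> ('a \<Rightarrow> real) \<Rightarrow> 'a \<Rightarrow> real" where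
  "transition \<Omega> X t f x = (\<integral>\<omega>. f (X x t \<omega>) \<partial>\<Omega> x)"

definition bounded_borel :: "('a::topological_space \<Rightarrow> real) \<Rightarrow> bool" where
  "bounded_borel f \<longleftrightarrow> f \<in> borel_measurable borel \<and> bounded (range f)"

definition bounded_continuous :: "('a::topological_space \<Rightarrow> 'b::metric_space) \<Rightarrow> bool" where
  "bounded_continuous f \<longleftrightarrow> continuous_on UNIV f \<and> bounded (range f)"

definition natural_filtration :: "'w measure \<Rightarrow> (real \<Rightarrow> 'w \<Rightarrow> 'a::topological_space) \<Rightarrow> real \<Rightarrow> 'w measure" where
  "natural_filtration M X s =
     sigma (space M) {X r -` A \<inter> space M | r A. 0 \<le> r \<and> r \<le> s \<and> A \<in> sets borel}"

definition markov_family :: "('a::euclidean_space \<Rightarrow> 'w measure) \<Rightarrow> ('a \<Rightarrow> real \<Rightarrow> 'w \<Rightarrow> 'a) \<Rightarrow> bool" where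
  "markov_family \<Omega> X \<longleftrightarrow> (\<forall>x s t f. 0 \<le> s \<longrightarrow> 0 \<le> t \<longrightarrow> bounded_borel f \<longrightarrow>
     (AE \<omega> in \<Omega> x. real_cond_exp (\<Omega> x) (natural_filtration (\<Omega> x) (X x) s) (\<lambda>\<omega>. f (X x (s + t) \<omega>)) \<omega>
                     = transition \<Omega> X t f (X x s \<omega>)))"

definition feller_op :: "(('a::topological_space \<Rightarrow> real) \<Rightarrow> 'a \<Rightarrow> real) \<Rightarrow> bool" where
  "feller_op P \<longleftrightarrow> (\<forall>f. bounded_continuous f \<longrightarrow> bounded_continuous (P f))"

definition strong_feller_op :: "(('a::topological_space \<Rightarrow> real) \<Rightarrow> 'a \<Rightarrow> real) \<Rightarrow> bool" where
  "strong_feller_op P \<longleftrightarrow> (\<forall>f. bounded_borel f \<longrightarrow> bounded_continuous (P f))"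

end

theory Submission
  imports Defs
begin

text \<open>
  Write \<open>PX\<close> for the transition semigroup and \<open>PZ\<close> for the convolution semigroup of \<open>Z\<close>.
  Two Gaussian densities of variance \<open>r\<close> whose centres differ by \<open>v\<close> are at \<open>L1\<close>-distance at
  most \<open>|v| / sqrt r\<close>; conditioning on \<open>T\<close> and \<open>\<xi>\<close>, the function \<open>PZ t f\<close> is therefore Lipschitz
  with constant \<open>\<rho> t = E T_t^(-1/2)\<close> for every Borel \<open>f\<close> with values in \<open>[0,1]\<close>. Over a short time
  \<open>d\<close> the drift moves \<open>X\<close> by at most \<open>\<beta> d\<close>, where \<open>\<beta>\<close> bounds \<open>b\<close>, so
  \<open>|PX d g - PZ d g| \<le> Lip(g) \<beta> d\<close>. Telescoping
  \<open>PX (d + t) - PZ (d + t) = PX d (PX t - PZ t) + (PX d - PZ d) PZ t\<close> and letting \<open>d\<close> tend to zero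
  gives \<open>|PX h g - PZ h g| \<le> \<beta> \<integral>\<^sub>0\<^sup>h \<rho>\<close> for all Lipschitz \<open>g\<close> with values in \<open>[0,1]\<close>.
  The bound does not involve the Lipschitz constant of \<open>g\<close>, so regularity of measures extends it to
  Borel functions. Hence \<open>PX t f\<close> is the uniform limit, as \<open>h\<close> tends to zero, of
  \<open>PX (t - h) (PZ h f)\<close>, and these functions are continuous by the Feller property.
\<close>

section \<open>Total variation distance of shifted Gaussians\<close>

text \<open>Density of the centred normal law with covariance \<open>r\<close> times the identity,
  written as in \<open>wiener_process\<close> so that marginals match it syntactically. Only
  \<open>r > 0\<close> carries this meaning.\<close>

definition gauss_density :: "real \<Rightarrow> 'a::euclidean_space \<Rightarrow> real" where
  "gauss_density r v = (2 * pi * r) powr (- real DIM('a) / 2) * exp (- (norm v)\<^sup>2 / (2 * r))"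

lemma gauss_density_nonneg [simp]: "0 \<le> gauss_density r v"
  by (simp add: gauss_density_def)

text \<open>Measurability jointly in variance and point is what allows the random variance
  \<open>T t \<omega>\<close> to be inserted and integrals to be interchanged.\<close>

lemma measurable_gauss_density [measurable]:
  "(\<lambda>(r, v). gauss_density r v) \<in> borel_measurable (borel \<Otimes>\<^sub>M borel)"
  unfolding gauss_density_def by measurable

text \<open>Parallelogram identity in the exponent. The product of the two roots is again a
  Gaussian, so its integral, the Hellinger affinity, can be read off as the exponential
  factor.\<close>

lemma gauss_density_mult_midpoint:
  fixes u v :: "'a::euclidean_space"
  assumes "r > 0"
  shows "sqrt (gauss_density r u) * sqrt (gauss_density r v)
    = gauss_density r ((1/2) *\<^sub>R (u + v)) * exp (- (norm (u - v))\<^sup>2 / (8 * r))"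
proof -
  define C where "C = (2 * pi * r) powr (- real DIM('a) / 2)"
  have "- (norm u)\<^sup>2 / (2 * r) + - (norm v)\<^sup>2 / (2 * r)
    = 2 * (- (norm ((1/2) *\<^sub>R (u + v)))\<^sup>2 / (2 * r) + - (norm (u - v))\<^sup>2 / (8 * r))"
    using assms
    by (simp add: power2_norm_eq_inner inner_add inner_diff inner_commute field_simps)
  then have "gauss_density r u * gauss_density r v
    = (gauss_density r ((1/2) *\<^sub>R (u + v)) * exp (- (norm (u - v))\<^sup>2 / (8 * r)))\<^sup>2"
    unfolding gauss_density_def C_def[symmetric]
    by (simp add: power2_eq_square mult_exp_exp algebra_simps)
  then show ?thesis
    by (simp add: real_sqrt_mult[symmetric])
qed

lemma nn_integral_lborel_shift:
  fixes f :: "'a::euclidean_space \<Rightarrow> ennreal"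
  assumes [measurable]: "f \<in> borel_measurable borel"
  shows "(\<integral>\<^sup>+v. f (c + v) \<partial>lborel) = (\<integral>\<^sup>+v. f v \<partial>lborel)"
proof -
  have "(\<integral>\<^sup>+v. f v \<partial>lborel) = (\<integral>\<^sup>+v. f v \<partial>distr lborel borel ((+) c))"
    by (simp add: lborel_distr_plus)
  also have "\<dots> = (\<integral>\<^sup>+v. f (c + v) \<partial>lborel)"
    by (subst nn_integral_distr) auto
  finally show ?thesis by simp
qed

text \<open>AM-GM with weight \<open>l\<close> applied to the factorisation
  \<open>p - q = (sqrt p - sqrt q) * (sqrt p + sqrt q)\<close>.\<close>

lemma abs_diff_le_hellinger:
  fixes p q l :: real
  assumes "p \<ge> 0" "q \<ge> 0" "l > 0"
  shows "\<bar>p - q\<bar> \<le> (l * (p + q - 2 * (sqrt p * sqrt q)) + 2 * (p + q) / l) / 2"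
proof -
  define a where "a = sqrt p"
  define b where "b = sqrt q"
  have pq: "p = a\<^sup>2" "q = b\<^sup>2" "a \<ge> 0" "b \<ge> 0"
    using assms by (auto simp: a_def b_def)
  define A where "A = \<bar>a - b\<bar>"
  define B where "B = a + b"
  have "\<bar>p - q\<bar> = A * B"
    unfolding pq A_def B_def power2_eq_square square_diff_square_factored
    using pq by (simp add: abs_mult)
  moreover have "2 * l * (A * B) \<le> l\<^sup>2 * A\<^sup>2 + B\<^sup>2"
    using zero_le_power2[of "l * A - B"] by (simp add: power2_eq_square algebra_simps)
  moreover have "A\<^sup>2 = p + q - 2 * (a * b)"
    unfolding A_def pq by (simp add: power2_eq_square algebra_simps)
  moreover have "B\<^sup>2 \<le> 2 * (p + q)"
    unfolding B_def pq using zero_le_power2[of "a - b"] by (simp add: power2_eq_square algebra_simps)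
  ultimately have "2 * l * \<bar>p - q\<bar> \<le> l\<^sup>2 * (p + q - 2 * (a * b)) + 2 * (p + q)"
    by (simp add: algebra_simps)
  then have "2 * l * \<bar>p - q\<bar> / (2 * l) \<le> (l\<^sup>2 * (p + q - 2 * (a * b)) + 2 * (p + q)) / (2 * l)"
    using \<open>l > 0\<close> by (intro divide_right_mono) auto
  then show ?thesis
    using \<open>l > 0\<close> unfolding a_def b_def by (simp add: field_simps power2_eq_square)
qed

text \<open>Integrating the weighted Hellinger bound reduces the claim to
  \<open>1 - exp (- z) \<le> z\<close>. Unit mass is a hypothesis because it is supplied later by
  the law of the Wiener process.\<close>

lemma gauss_density_shift_L1:
  fixes x y :: "'a::euclidean_space"
  assumes r: "r > 0" and norm1: "(\<integral>\<^sup>+v. ennreal (gauss_density r (v::'a)) \<partial>lborel) = 1"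
  shows "(\<integral>\<^sup>+w. ennreal \<bar>gauss_density r (w - x) - gauss_density r (w - y)\<bar> \<partial>lborel)
    \<le> ennreal (norm (x - y) / sqrt r)"
proof (cases "x = y")
  case False
  define d where "d = norm (x - y)"
  have d: "d > 0" using False by (simp add: d_def)
  \<comment> \<open>the weight that balances the two terms of the AM-GM bound\<close>
  define l where "l = 4 * sqrt r / d"
  have l: "l > 0" using d r by (simp add: l_def)
  define a where "a = exp (- d\<^sup>2 / (8 * r))"
  let ?G = "\<lambda>c w::'a. gauss_density r (w - c)"
  let ?m = "(1/2) *\<^sub>R (x + y)"
  have G: "has_bochner_integral lborel (?G c) 1" for c
  proof (rule has_bochner_integral_nn_integral)
    have "(\<integral>\<^sup>+w. ennreal (?G c w) \<partial>lborel) = (\<integral>\<^sup>+w. ennreal (?G c (c + w)) \<partial>lborel)"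
      by (rule nn_integral_lborel_shift[symmetric]) measurable
    then show "(\<integral>\<^sup>+w. ennreal (?G c w) \<partial>lborel) = ennreal 1"
      using norm1 by simp
  qed auto
  let ?D = "\<lambda>w. (l * (?G x w + ?G y w - 2 * (?G ?m w * a)) + 2 * (?G x w + ?G y w) / l) / 2"
  \<comment> \<open>All three shifted Gaussians have mass one, so the product of the roots
    integrates to the constant \<open>a\<close>.\<close>
  have D: "has_bochner_integral lborel ?D ((l * (1 + 1 - 2 * (1 * a)) + 2 * (1 + 1) / l) / 2)"
    by (intro has_bochner_integral_divide has_bochner_integral_add has_bochner_integral_diff
        has_bochner_integral_mult_right has_bochner_integral_mult_left G)
  have le: "\<bar>?G x w - ?G y w\<bar> \<le> ?D w" for w
  proof -
    have "sqrt (?G x w) * sqrt (?G y w) = ?G ?m w * a"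
      using gauss_density_mult_midpoint[OF r, of "w - x" "w - y"]
      by (simp add: a_def d_def norm_minus_commute scaleR_right_diff_distrib scaleR_right_distrib
          algebra_simps scaleR_left_distrib[symmetric])
    then show ?thesis
      using abs_diff_le_hellinger[of "?G x w" "?G y w" l] l by simp
  qed
  have "(\<integral>\<^sup>+w. ennreal \<bar>?G x w - ?G y w\<bar> \<partial>lborel) \<le> (\<integral>\<^sup>+w. ennreal (?D w) \<partial>lborel)"
    by (intro nn_integral_mono ennreal_leI le)
  also have "\<dots> = ennreal ((l * (1 + 1 - 2 * (1 * a)) + 2 * (1 + 1) / l) / 2)"
    using nn_integral_eq_integral[of lborel ?D] D order_trans[OF abs_ge_zero le]
    unfolding has_bochner_integral_iff by (metis (mono_tags, lifting) AE_I2)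
  also have "\<dots> \<le> ennreal (d / sqrt r)"
  proof (rule ennreal_leI)
    \<comment> \<open>With this, the Hellinger term is at most \<open>d / sqrt r\<close>, the very
      value of the other term; the bound is the mean of the two.\<close>
    have "1 - a \<le> d\<^sup>2 / (8 * r)"
      using exp_ge_add_one_self[of "- d\<^sup>2 / (8 * r)"] by (simp add: a_def)
    then have "l * (2 * (1 - a)) \<le> l * (2 * (d\<^sup>2 / (8 * r)))"
      using l by (intro mult_left_mono) auto
    also have "\<dots> = d / sqrt r"
      using d r by (simp add: l_def field_simps power2_eq_square)
    finally have "l * (1 + 1 - 2 * (1 * a)) \<le> d / sqrt r" by (simp add: algebra_simps)
    moreover have "2 * (1 + 1) / l = d / sqrt r"
      using d r by (simp add: l_def field_simps)
    moreover have "(A + B) / 2 \<le> C" if "A \<le> C" "B = C" for A B C :: real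
      using that by simp
    ultimately show "(l * (1 + 1 - 2 * (1 * a)) + 2 * (1 + 1) / l) / 2 \<le> d / sqrt r" by blast
  qed
  finally show ?thesis by (simp add: d_def)
qed simp

text \<open>Translation moves the centre from \<open>g\<close> to the density; since
  \<open>g\<close> is at most one, the L1 distance of the densities bounds the difference. The
  one-sided form avoids subtraction in \<open>ennreal\<close>.\<close>

lemma gauss_density_shift_le:
  fixes x y :: "'a::euclidean_space" and g :: "'a \<Rightarrow> ennreal"
  assumes r: "r > 0" and norm1: "(\<integral>\<^sup>+v. ennreal (gauss_density r (v::'a)) \<partial>lborel) = 1"
    and [measurable]: "g \<in> borel_measurable borel" and g1: "\<And>v. g v \<le> 1"
  shows "(\<integral>\<^sup>+v. g (x + v) * ennreal (gauss_density r v) \<partial>lborel)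
    \<le> (\<integral>\<^sup>+v. g (y + v) * ennreal (gauss_density r v) \<partial>lborel) + ennreal (norm (x - y) / sqrt r)"
proof -
  let ?G = "\<lambda>c w::'a. gauss_density r (w - c)"
  have sh: "(\<integral>\<^sup>+v. g (c + v) * ennreal (gauss_density r v) \<partial>lborel)
    = (\<integral>\<^sup>+w. g w * ennreal (?G c w) \<partial>lborel)" for c
    using nn_integral_lborel_shift[of "\<lambda>w. g w * ennreal (?G c w)" c] by simp
  have "(\<integral>\<^sup>+w. g w * ennreal (?G x w) \<partial>lborel)
    \<le> (\<integral>\<^sup>+w. g w * ennreal (?G y w) + ennreal \<bar>?G x w - ?G y w\<bar> \<partial>lborel)"
  proof (rule nn_integral_mono)
    fix w
    have "ennreal (?G x w) \<le> ennreal (?G y w) + ennreal \<bar>?G x w - ?G y w\<bar>"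
      using ennreal_leI[of "?G x w" "?G y w + \<bar>?G x w - ?G y w\<bar>"] by simp
    then have "g w * ennreal (?G x w) \<le> g w * (ennreal (?G y w) + ennreal \<bar>?G x w - ?G y w\<bar>)"
      by (rule mult_left_mono) simp
    also have "\<dots> \<le> g w * ennreal (?G y w) + 1 * ennreal \<bar>?G x w - ?G y w\<bar>"
      unfolding distrib_left by (intro add_left_mono mult_right_mono g1) simp
    finally show "g w * ennreal (?G x w) \<le> g w * ennreal (?G y w) + ennreal \<bar>?G x w - ?G y w\<bar>"
      by simp
  qed
  also have "\<dots> = (\<integral>\<^sup>+w. g w * ennreal (?G y w) \<partial>lborel) + (\<integral>\<^sup>+w. ennreal \<bar>?G x w - ?G y w\<bar> \<partial>lborel)"
    by (rule nn_integral_add) measurable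
  also have "\<dots> \<le> (\<integral>\<^sup>+w. g w * ennreal (?G y w) \<partial>lborel) + ennreal (norm (x - y) / sqrt r)"
    by (intro add_left_mono gauss_density_shift_L1 r norm1)
  finally show ?thesis by (simp add: sh)
qed

section \<open>Independence and Levy processes\<close>

text \<open>The product formula on rectangles identifies the joint law with the product law; Tonelli
  does the rest. Independent copies are expressed by a second integral over the same
  \<open>M\<close>, so no product space appears later.\<close>

lemma (in prob_space) nn_integral_indep_pair:
  fixes F :: "'b \<times> 'c \<Rightarrow> ennreal"
  assumes [measurable]: "X \<in> measurable M S" "Y \<in> measurable M T" "F \<in> borel_measurable (S \<Otimes>\<^sub>M T)"
    and ind: "\<And>A B. A \<in> sets S \<Longrightarrow> B \<in> sets T \<Longrightarrow>
      prob ((X -` A \<inter> space M) \<inter> (Y -` B \<inter> space M)) = prob (X -` A \<inter> space M) * prob (Y -` B \<inter> space M)"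
  shows "(\<integral>\<^sup>+\<omega>. F (X \<omega>, Y \<omega>) \<partial>M) = (\<integral>\<^sup>+\<omega>. \<integral>\<^sup>+\<omega>'. F (X \<omega>, Y \<omega>') \<partial>M \<partial>M)"
proof -
  interpret X: prob_space "distr M S X" by (rule prob_space_distr) simp
  interpret Y: prob_space "distr M T Y" by (rule prob_space_distr) simp
  have eq: "distr M S X \<Otimes>\<^sub>M distr M T Y = distr M (S \<Otimes>\<^sub>M T) (\<lambda>\<omega>. (X \<omega>, Y \<omega>))"
  proof (rule pair_measure_eqI)
    fix A B assume "A \<in> sets (distr M S X)" "B \<in> sets (distr M T Y)"
    then have [measurable]: "A \<in> sets S" "B \<in> sets T" by auto
    have "(\<lambda>\<omega>. (X \<omega>, Y \<omega>)) -` (A \<times> B) \<inter> space M = (X -` A \<inter> space M) \<inter> (Y -` B \<inter> space M)"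
      by auto
    then show "emeasure (distr M S X) A * emeasure (distr M T Y) B
      = emeasure (distr M (S \<Otimes>\<^sub>M T) (\<lambda>\<omega>. (X \<omega>, Y \<omega>))) (A \<times> B)"
      by (simp add: emeasure_distr emeasure_eq_measure ind ennreal_mult)
  qed (auto intro: X.sigma_finite_measure_axioms Y.sigma_finite_measure_axioms cong: sets_pair_measure_cong)
  have "(\<integral>\<^sup>+\<omega>. F (X \<omega>, Y \<omega>) \<partial>M) = (\<integral>\<^sup>+z. F z \<partial>(distr M S X \<Otimes>\<^sub>M distr M T Y))"
    by (simp add: eq nn_integral_distr)
  also have "\<dots> = (\<integral>\<^sup>+x. \<integral>\<^sup>+y. F (x, y) \<partial>distr M T Y \<partial>distr M S X)"
    by (rule Y.nn_integral_fst[symmetric]) simp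
  also have "\<dots> = (\<integral>\<^sup>+\<omega>. \<integral>\<^sup>+\<omega>'. F (X \<omega>, Y \<omega>') \<partial>M \<partial>M)"
  proof (subst nn_integral_distr)
    show "(\<integral>\<^sup>+\<omega>. \<integral>\<^sup>+y. F (X \<omega>, y) \<partial>distr M T Y \<partial>M) = (\<integral>\<^sup>+\<omega>. \<integral>\<^sup>+\<omega>'. F (X \<omega>, Y \<omega>') \<partial>M \<partial>M)"
    proof (rule nn_integral_cong)
      fix \<omega> assume "\<omega> \<in> space M"
      then have [measurable]: "X \<omega> \<in> space S" by (rule measurable_space[rotated]) simp
      show "(\<integral>\<^sup>+y. F (X \<omega>, y) \<partial>distr M T Y) = (\<integral>\<^sup>+\<omega>'. F (X \<omega>, Y \<omega>') \<partial>M)"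
        by (simp add: nn_integral_distr)
    qed
  qed auto
  finally show ?thesis .
qed

lemma (in prob_space) nn_integral_indep_processes:
  fixes X :: "real \<Rightarrow> 'a \<Rightarrow> 'b::topological_space" and Y :: "real \<Rightarrow> 'a \<Rightarrow> 'c::topological_space"
    and F :: "'b \<times> 'c \<Rightarrow> ennreal"
  assumes ind: "indep_processes M X Y" and st: "0 \<le> s" "0 \<le> t"
    and [measurable]: "F \<in> borel_measurable (borel \<Otimes>\<^sub>M borel)"
  shows "(\<integral>\<^sup>+\<omega>. F (X s \<omega>, Y t \<omega>) \<partial>M) = (\<integral>\<^sup>+\<omega>. \<integral>\<^sup>+\<omega>'. F (X s \<omega>, Y t \<omega>') \<partial>M \<partial>M)"
proof (rule nn_integral_indep_pair)
  fix A :: "'b set" and B :: "'c set" assume "A \<in> sets borel" "B \<in> sets borel"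
  then show "prob ((X s -` A \<inter> space M) \<inter> (Y t -` B \<inter> space M))
    = prob (X s -` A \<inter> space M) * prob (Y t -` B \<inter> space M)"
    using ind st unfolding indep_processes_def indep_sets2_eq
    by (blast intro: sigma_sets.Basic)
qed (use ind st in \<open>auto simp: indep_processes_def\<close>)

lemma levy_process_measurable:
  "levy_process M L \<Longrightarrow> 0 \<le> t \<Longrightarrow> L t \<in> borel_measurable M"
  by (simp add: levy_process_def)

text \<open>The increments over \<open>[0, s]\<close> and \<open>[s, s + t]\<close> are independent
  and the second has the law of \<open>L t\<close>. Since \<open>L 0\<close> vanishes only almost
  surely, it is first subtracted and then removed under the integral.\<close>

lemma nn_integral_levy_process_add:
  fixes L :: "real \<Rightarrow> 'w \<Rightarrow> 'a::euclidean_space" and f :: "'a \<Rightarrow> ennreal"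
  assumes L: "levy_process M L" and s: "0 < s" and t: "0 < t"
    and [measurable]: "f \<in> borel_measurable borel"
  shows "(\<integral>\<^sup>+\<omega>. f (L (s + t) \<omega>) \<partial>M) = (\<integral>\<^sup>+\<omega>. \<integral>\<^sup>+\<omega>'. f (L s \<omega> + L t \<omega>') \<partial>M \<partial>M)"
proof -
  interpret prob_space M using L by (simp add: levy_process_def)
  have [measurable]: "L 0 \<in> borel_measurable M" "L s \<in> borel_measurable M"
    "L t \<in> borel_measurable M" "L (s + t) \<in> borel_measurable M"
    using L s t by (auto intro: levy_process_measurable)
  have L0: "AE \<omega> in M. L 0 \<omega> = 0" using L by (simp add: levy_process_def)
  \<comment> \<open>The grid 0, \<open>s\<close>, \<open>s + t\<close>, whose two increments are
    those in question. It must increase strictly, whence \<open>s\<close> and \<open>t\<close> are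
    positive.\<close>
  define ts :: "nat \<Rightarrow> real" where "ts = (\<lambda>i. if i = 0 then 0 else if i = 1 then s else s + t)"
  have "indep_vars (\<lambda>_. borel) (\<lambda>i \<omega>. L (ts (Suc i)) \<omega> - L (ts i) \<omega>) {..<2}"
  proof -
    have "0 \<le> ts 0 \<and> (\<forall>i<2. ts i < ts (Suc i))"
      using s t by (auto simp: ts_def less_Suc_eq numeral_2_eq_2)
    then show ?thesis using L unfolding levy_process_def by blast
  qed
  then have ind: "prob (((\<lambda>\<omega>. L s \<omega> - L 0 \<omega>) -` A \<inter> space M) \<inter> ((\<lambda>\<omega>. L (s + t) \<omega> - L s \<omega>) -` B \<inter> space M))
    = prob ((\<lambda>\<omega>. L s \<omega> - L 0 \<omega>) -` A \<inter> space M) * prob ((\<lambda>\<omega>. L (s + t) \<omega> - L s \<omega>) -` B \<inter> space M)"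
    if "A \<in> sets borel" "B \<in> sets borel" for A B
    using that indep_varsD[where J="{..<2}" and A="\<lambda>i. if i = 0 then A else B"]
    by (fastforce simp: ts_def numeral_2_eq_2 lessThan_Suc Int_ac)
  have incr: "distr M borel (\<lambda>\<omega>. L (s + t) \<omega> - L s \<omega>) = distr M borel (L t)"
    using L s t by (simp add: levy_process_def)
  have "(\<integral>\<^sup>+\<omega>. f (L (s + t) \<omega>) \<partial>M) = (\<integral>\<^sup>+\<omega>. f ((L s \<omega> - L 0 \<omega>) + (L (s + t) \<omega> - L s \<omega>)) \<partial>M)"
    using L0 by (intro nn_integral_cong_AE) (auto elim!: eventually_mono)
  also have "\<dots> = (\<integral>\<^sup>+\<omega>. \<integral>\<^sup>+\<omega>'. f ((L s \<omega> - L 0 \<omega>) + (L (s + t) \<omega>' - L s \<omega>')) \<partial>M \<partial>M)"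
    using nn_integral_indep_pair[of "\<lambda>\<omega>. L s \<omega> - L 0 \<omega>" borel "\<lambda>\<omega>. L (s + t) \<omega> - L s \<omega>" borel "\<lambda>(x, y). f (x + y)"] ind
    by simp
  also have "\<dots> = (\<integral>\<^sup>+\<omega>. \<integral>\<^sup>+\<omega>'. f (L s \<omega> + (L (s + t) \<omega>' - L s \<omega>')) \<partial>M \<partial>M)"
    using L0 by (intro nn_integral_cong_AE) (auto elim!: eventually_mono)
  also have "\<dots> = (\<integral>\<^sup>+\<omega>. \<integral>\<^sup>+y. f (L s \<omega> + y) \<partial>distr M borel (\<lambda>\<omega>. L (s + t) \<omega> - L s \<omega>) \<partial>M)"
    by (simp add: nn_integral_distr)
  also have "\<dots> = (\<integral>\<^sup>+\<omega>. \<integral>\<^sup>+\<omega>'. f (L s \<omega> + L t \<omega>') \<partial>M \<partial>M)"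
    by (simp add: incr nn_integral_distr)
  finally show ?thesis .
qed

section \<open>Gaussian marginals of the Wiener process\<close>

lemma nn_integral_wiener_process:
  fixes W :: "real \<Rightarrow> 'w \<Rightarrow> 'a::euclidean_space" and f :: "'a \<Rightarrow> ennreal"
  assumes W: "wiener_process M W" and r: "0 < r" and [measurable]: "f \<in> borel_measurable borel"
  shows "(\<integral>\<^sup>+\<omega>. f (W r \<omega>) \<partial>M) = (\<integral>\<^sup>+v. f v * ennreal (gauss_density r v) \<partial>lborel)"
proof -
  have [measurable]: "W r \<in> borel_measurable M"
    using W r by (auto simp: wiener_process_def intro: levy_process_measurable)
  have eq: "distr M borel (W r) = density lborel (\<lambda>x. ennreal (gauss_density r x))"
    using W r by (simp add: wiener_process_def gauss_density_def)
  have "(\<integral>\<^sup>+\<omega>. f (W r \<omega>) \<partial>M) = (\<integral>\<^sup>+v. f v \<partial>distr M borel (W r))"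
    by (simp add: nn_integral_distr)
  also have "\<dots> = (\<integral>\<^sup>+v. ennreal (gauss_density r v) * f v \<partial>lborel)"
    unfolding eq by (rule nn_integral_density) measurable
  finally show ?thesis by (simp add: mult.commute)
qed

text \<open>The density is that of a probability law, so no Gaussian integral has to be
  computed.\<close>

lemma wiener_process_gauss_density_norm:
  fixes W :: "real \<Rightarrow> 'w \<Rightarrow> 'a::euclidean_space"
  assumes W: "wiener_process M W" and r: "0 < r"
  shows "(\<integral>\<^sup>+v. ennreal (gauss_density r (v::'a)) \<partial>lborel) = 1"
proof -
  interpret prob_space M using W by (simp add: wiener_process_def levy_process_def)
  show ?thesis
    using nn_integral_wiener_process[OF W r, of "\<lambda>_. 1"] by (simp add: emeasure_space_1)
qed

text \<open>Variances add under convolution: the increments of \<open>W\<close> give this at once,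
  without completing squares.\<close>

lemma gauss_density_add:
  fixes f :: "'a::euclidean_space \<Rightarrow> ennreal" and W :: "real \<Rightarrow> 'w \<Rightarrow> 'a"
  assumes W: "wiener_process M W" and "0 < r" "0 < q" and [measurable]: "f \<in> borel_measurable borel"
  shows "(\<integral>\<^sup>+v. f v * ennreal (gauss_density (r + q) v) \<partial>lborel)
    = (\<integral>\<^sup>+u. (\<integral>\<^sup>+v. f (u + v) * ennreal (gauss_density q v) \<partial>lborel) * ennreal (gauss_density r u) \<partial>lborel)"
proof -
  have L: "levy_process M W" using W by (simp add: wiener_process_def)
  then interpret prob_space M by (simp add: levy_process_def)
  have [measurable]: "W r \<in> borel_measurable M" "W q \<in> borel_measurable M"
    using L assms by (auto intro: levy_process_measurable)
  let ?H = "\<lambda>u. \<integral>\<^sup>+v. f (u + v) * ennreal (gauss_density q v) \<partial>lborel"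
  have "(\<integral>\<^sup>+v. f v * ennreal (gauss_density (r + q) v) \<partial>lborel)
    = (\<integral>\<^sup>+\<omega>. \<integral>\<^sup>+\<omega>'. f (W r \<omega> + W q \<omega>') \<partial>M \<partial>M)"
    using nn_integral_levy_process_add[OF L \<open>0 < r\<close> \<open>0 < q\<close>, of f]
    by (simp add: nn_integral_wiener_process[OF W] assms add_pos_pos)
  also have "\<dots> = (\<integral>\<^sup>+\<omega>. ?H (W r \<omega>) \<partial>M)"
    using nn_integral_wiener_process[OF W \<open>0 < q\<close>, of "\<lambda>v. f (W r _ + v)"] by simp
  also have "\<dots> = (\<integral>\<^sup>+u. ?H u * ennreal (gauss_density r u) \<partial>lborel)"
    by (rule nn_integral_wiener_process[OF W \<open>0 < r\<close>]) measurable
  finally show ?thesis .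
qed

section \<open>Comparing measures through Lipschitz functions\<close>

text \<open>Lipschitz functions with constant \<open>n\<close> that decrease to the indicator of a
  closed \<open>C\<close>. As \<open>infdist\<close> to the empty set is 0, the cutoff of the empty
  set is constantly 1, so that set is treated apart below.\<close>

definition closed_cutoff :: "'a::metric_space set \<Rightarrow> nat \<Rightarrow> 'a \<Rightarrow> real" where
  "closed_cutoff C n x = max 0 (1 - real n * infdist x C)"

lemma closed_cutoff_bounds: "0 \<le> closed_cutoff C n x" "closed_cutoff C n x \<le> 1"
  by (auto simp: closed_cutoff_def infdist_nonneg)

lemma closed_cutoff_lipschitz: "\<bar>closed_cutoff C n x - closed_cutoff C n y\<bar> \<le> real n * dist x y"
proof -
  have "\<bar>infdist x C - infdist y C\<bar> \<le> dist x y"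
    by (rule infdist_triangle_abs)
  then have "real n * \<bar>infdist x C - infdist y C\<bar> \<le> real n * dist x y"
    by (rule mult_left_mono) simp
  then have "\<bar>real n * infdist x C - real n * infdist y C\<bar> \<le> real n * dist x y"
    by (simp add: abs_mult flip: right_diff_distrib)
  then show ?thesis by (auto simp: closed_cutoff_def)
qed

lemma continuous_on_closed_cutoff [continuous_intros]: "continuous_on A (closed_cutoff C n)"
  unfolding closed_cutoff_def by (intro continuous_intros)

text \<open>Off a closed set the distance is positive, so the cutoff is eventually zero there; on
  the set it is always one.\<close>

lemma closed_cutoff_tendsto:
  assumes "closed C" "C \<noteq> {}"
  shows "(\<lambda>n. closed_cutoff C n x) \<longlonglongrightarrow> indicator C x"
proof (cases "x \<in> C")
  case False
  then have pos: "infdist x C > 0"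
    using assms by (metis in_closed_iff_infdist_zero infdist_nonneg less_eq_real_def)
  obtain k :: nat where k: "real k * infdist x C > 1"
    using reals_Archimedean3[OF pos] by blast
  have "closed_cutoff C n x = 0" if "n \<ge> k" for n
  proof -
    have "real k * infdist x C \<le> real n * infdist x C"
      using that pos by (intro mult_right_mono) auto
    then show ?thesis using k by (auto simp: closed_cutoff_def)
  qed
  then have "eventually (\<lambda>n. closed_cutoff C n x = indicator C x) sequentially"
    using False by (auto simp: eventually_sequentially)
  then show ?thesis by (rule tendsto_eventually)
qed (simp add: closed_cutoff_def)

section \<open>Measures determined and compared through cutoffs\<close>

lemma integral_closed_cutoff_tendsto:
  fixes M :: "'a::euclidean_space measure"
  assumes "finite_measure M" and [measurable_cong]: "sets M = sets borel" and C: "closed C" "C \<noteq> {}"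
  shows "(\<lambda>n. \<integral>x. closed_cutoff C n x \<partial>M) \<longlonglongrightarrow> measure M C"
proof -
  interpret finite_measure M by fact
  have [measurable]: "C \<in> sets M" "C \<in> sets borel" "closed_cutoff C n \<in> borel_measurable borel" for n
    using C assms by (auto intro!: borel_measurable_continuous_onI continuous_intros)
  have "(\<lambda>n. \<integral>x. closed_cutoff C n x \<partial>M) \<longlonglongrightarrow> (\<integral>x. indicator C x \<partial>M)"
  proof (rule integral_dominated_convergence[where w="\<lambda>_. 1"])
    show "AE x in M. (\<lambda>n. closed_cutoff C n x) \<longlonglongrightarrow> indicat_real C x"
      using C by (simp add: closed_cutoff_tendsto)
    show "AE x in M. norm (closed_cutoff C n x) \<le> 1" for n
      using closed_cutoff_bounds[of C n] by simp
  qed auto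
  then show ?thesis
    using sets_eq_imp_space_eq[OF assms(2)] by (simp add: Int_absorb1)
qed

text \<open>Cutoffs give equality on closed sets, an intersection-stable generator of the Borel
  sets. This later upgrades an identity for continuous test functions to an identity of
  laws.\<close>

lemma finite_measure_eqI_continuous:
  fixes M N :: "'a::euclidean_space measure"
  assumes "finite_measure M" "finite_measure N"
    and M: "sets M = sets borel" and N: "sets N = sets borel"
    and eq: "\<And>g. continuous_on UNIV g \<Longrightarrow> (\<And>x. 0 \<le> g x) \<Longrightarrow> (\<And>x. g x \<le> (1::real)) \<Longrightarrow>
      (\<integral>x. g x \<partial>M) = (\<integral>x. g x \<partial>N)"
  shows "M = N"
proof (rule measure_eqI_generator_eq[where E="{C. closed C}" and \<Omega>=UNIV and A="\<lambda>_. UNIV"])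
  interpret M: finite_measure M by fact
  interpret N: finite_measure N by fact
  show "Int_stable {C::'a set. closed C}" by (auto simp: Int_stable_def)
  have "sigma_sets UNIV {C::'a set. closed C} = sets borel"
    by (subst borel_eq_closed) simp
  then show "sets M = sigma_sets UNIV {C. closed C}" "sets N = sigma_sets UNIV {C. closed C}"
    using M N by simp_all
  show "emeasure M C = emeasure N C" if "C \<in> {C. closed C}" for C
  proof (cases "C = {}")
    case False
    have "(\<integral>x. closed_cutoff C n x \<partial>M) = (\<integral>x. closed_cutoff C n x \<partial>N)" for n
      by (intro eq closed_cutoff_bounds continuous_intros)
    then have "measure M C = measure N C"
      using integral_closed_cutoff_tendsto[of M C] integral_closed_cutoff_tendsto[of N C] assms that False
      by (auto intro: LIMSEQ_unique)
    then show ?thesis by (simp add: M.emeasure_eq_measure N.emeasure_eq_measure)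
  qed simp
  show "emeasure M UNIV \<noteq> \<infinity>" by (simp add: M.emeasure_eq_measure)
qed auto

text \<open>Because \<open>K\<close> is the same for every Lipschitz constant, it survives the limit
  of the cutoffs and holds on closed sets; inner regularity carries it to Borel sets.\<close>

lemma measure_diff_le_of_lipschitz:
  fixes M N :: "'a::euclidean_space measure"
  assumes "prob_space M" "prob_space N"
    and M: "sets M = sets borel" and N: "sets N = sets borel"
    and le: "\<And>g k. 0 \<le> k \<Longrightarrow> (\<And>x y. \<bar>g x - g y\<bar> \<le> k * dist x y) \<Longrightarrow> (\<And>x. 0 \<le> g x) \<Longrightarrow> (\<And>x. g x \<le> (1::real)) \<Longrightarrow>
      \<bar>(\<integral>x. g x \<partial>M) - (\<integral>x. g x \<partial>N)\<bar> \<le> K"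
    and B: "B \<in> sets borel"
  shows "\<bar>measure M B - measure N B\<bar> \<le> K"
proof -
  interpret M: prob_space M by fact
  interpret N: prob_space N by fact
  have K: "K \<ge> 0" using le[of 0 "\<lambda>_. 0"] by simp
  have cl: "\<bar>measure M C - measure N C\<bar> \<le> K" if "closed C" for C
  proof (cases "C = {}")
    case False
    have "(\<lambda>n. \<bar>(\<integral>x. closed_cutoff C n x \<partial>M) - (\<integral>x. closed_cutoff C n x \<partial>N)\<bar>) \<longlonglongrightarrow> \<bar>measure M C - measure N C\<bar>"
      by (intro tendsto_intros integral_closed_cutoff_tendsto M.finite_measure_axioms N.finite_measure_axioms M N that False)
    moreover have "\<bar>(\<integral>x. closed_cutoff C n x \<partial>M) - (\<integral>x. closed_cutoff C n x \<partial>N)\<bar> \<le> K" for n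
      by (rule le[of "real n"]) (simp_all add: closed_cutoff_bounds closed_cutoff_lipschitz)
    ultimately show ?thesis by (blast intro: LIMSEQ_le_const2)
  qed (simp add: K)
  have app: "\<exists>C. closed C \<and> C \<subseteq> B \<and> measure P B \<le> measure P C + e"
    if "prob_space P" "sets P = sets borel" "e > 0" for P :: "'a measure" and e
  proof -
    interpret P: prob_space P by fact
    have SUP: "emeasure P B = (SUP K \<in> {K. K \<subseteq> B \<and> compact K}. emeasure P K)"
      by (rule inner_regular) (use that B in auto)
    show ?thesis
    proof (rule ccontr)
      assume *: "\<nexists>C. closed C \<and> C \<subseteq> B \<and> measure P B \<le> measure P C + e"
      have le: "measure P C \<le> measure P B - e" if "compact C" "C \<subseteq> B" for C
      proof -
        have "\<not> measure P B \<le> measure P C + e"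
          using * that compact_imp_closed[OF that(1)] by blast
        then show ?thesis by linarith
      qed
      have "emeasure P B \<le> ennreal (measure P B - e)"
        unfolding SUP
        by (rule SUP_least) (simp add: P.emeasure_eq_measure ennreal_leI le)
      \<comment> \<open>Without this, \<open>ennreal\<close> could truncate a negative number to
        zero and no contradiction would result.\<close>
      moreover have "0 \<le> measure P B - e" using le[of "{}"] by simp
      ultimately show False using \<open>e > 0\<close> by (simp add: P.emeasure_eq_measure)
    qed
  qed
  have "\<bar>measure M B - measure N B\<bar> \<le> K + e" if "e > 0" for e
  proof -
    \<comment> \<open>Each measure needs its own inner approximation: \<open>C\<close> bounds
      \<open>measure M B - measure N B\<close> from above, \<open>D\<close> the opposite
      difference.\<close>
    obtain C where C: "closed C" "C \<subseteq> B" "measure M B \<le> measure M C + e"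
      using app[OF \<open>prob_space M\<close> M \<open>e > 0\<close>] by blast
    obtain D where D: "closed D" "D \<subseteq> B" "measure N B \<le> measure N D + e"
      using app[OF \<open>prob_space N\<close> N \<open>e > 0\<close>] by blast
    have "measure N C \<le> measure N B" "measure M D \<le> measure M B"
      using C D B M N by (auto intro!: N.finite_measure_mono M.finite_measure_mono)
    then show ?thesis using cl[of C] cl[of D] C D by linarith
  qed
  then show ?thesis by (rule field_le_epsilon)
qed

text \<open>A discrete layer-cake formula: \<open>f\<close> is uniformly close to an average of
  \<open>n\<close> indicators of superlevel sets. Averaging preserves the bound \<open>K\<close>
  exactly, so no factor is lost in passing from sets to functions.\<close>

lemma integral_diff_le_of_measure:
  fixes M N :: "'a::topological_space measure"
  assumes "prob_space M" "prob_space N"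
    and M[measurable_cong]: "sets M = sets borel" and N[measurable_cong]: "sets N = sets borel"
    and le: "\<And>B. B \<in> sets borel \<Longrightarrow> \<bar>measure M B - measure N B\<bar> \<le> K"
    and f[measurable]: "f \<in> borel_measurable borel" and f0: "\<And>x. 0 \<le> f x" and f1: "\<And>x. f x < (1::real)"
  shows "\<bar>(\<integral>x. f x \<partial>M) - (\<integral>x. f x \<partial>N)\<bar> \<le> K"
proof -
  define F where "F n k = {x. real (Suc k) \<le> real n * f x}" for n k :: nat
  have [measurable]: "F n k \<in> sets borel" for n k unfolding F_def by measurable
  define S where "S n x = (\<Sum>k<n. indicat_real (F n k) x) / real n" for n x
  have sum_eq: "(\<Sum>k<n. indicat_real (F n k) x) = of_int \<lfloor>real n * f x\<rfloor>" for n x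
  proof -
    define m where "m = nat \<lfloor>real n * f x\<rfloor>"
    have m0: "0 \<le> real n * f x" by (simp add: f0)
    \<comment> \<open>The index shift in \<open>F\<close> makes membership equivalent to
      \<open>k < m\<close>, so the number of superlevel sets containing \<open>x\<close> is the
      floor of \<open>real n * f x\<close>.\<close>
    have F: "x \<in> F n k \<longleftrightarrow> k < m" for k
      unfolding F_def m_def using m0 by (simp add: zless_nat_eq_int_zless less_floor_iff) (simp add: algebra_simps)
    have "m \<le> n"
    proof -
      have "real n * f x \<le> real n" using f1[of x] by (simp add: mult_left_le less_imp_le)
      then have "\<lfloor>real n * f x\<rfloor> \<le> int n" by linarith
      then show ?thesis by (simp add: m_def)
    qed
    have "(\<Sum>k<n. indicat_real (F n k) x) = (\<Sum>k<n. if k < m then 1 else 0)"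
      by (rule sum.cong) (auto simp: F indicator_def)
    also have "\<dots> = real (card ({..<n} \<inter> {k. k < m}))"
      by (simp add: sum.If_cases)
    also have "{..<n} \<inter> {k. k < m} = {..<m}" using \<open>m \<le> n\<close> by auto
    finally show ?thesis using m0 by (simp add: m_def)
  qed
  have S: "\<bar>f x - S n x\<bar> \<le> 1 / real n" if "n > 0" for n x
  proof -
    have "\<bar>real n * f x - of_int \<lfloor>real n * f x\<rfloor>\<bar> \<le> 1" by linarith
    then have "\<bar>real n * f x - of_int \<lfloor>real n * f x\<rfloor>\<bar> / real n \<le> 1 / real n"
      by (rule divide_right_mono) simp
    moreover have "f x - S n x = (real n * f x - of_int \<lfloor>real n * f x\<rfloor>) / real n"
      using that by (simp add: S_def sum_eq field_simps)
    ultimately show ?thesis using that by (simp add: abs_divide)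
  qed
  have near: "\<bar>(\<integral>x. f x \<partial>P) - (\<integral>x. S n x \<partial>P)\<bar> \<le> 1 / real n"
    and int_S: "(\<integral>x. S n x \<partial>P) = (\<Sum>k<n. measure P (F n k)) / real n"
    if "prob_space P" and P[measurable_cong]: "sets P = sets borel" and "n > 0" for P :: "'a measure" and n
  proof -
    interpret P: prob_space P by fact
    have sp: "space P = UNIV" using sets_eq_imp_space_eq[OF P] by simp
    have i: "integrable P f"
      by (rule P.integrable_const_bound[where B=1]) (use f0 f1 in \<open>auto simp: less_imp_le\<close>)
    have iF: "integrable P (indicat_real (F n k))" for k
      by (simp add: P.emeasure_eq_measure)
    have iS: "integrable P (S n)"
      unfolding S_def by (intro integrable_divide Bochner_Integration.integrable_sum iF)
    have "\<bar>\<integral>x. f x - S n x \<partial>P\<bar> \<le> (\<integral>x. \<bar>f x - S n x\<bar> \<partial>P)"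
      by (rule integral_abs_bound)
    also have "\<dots> \<le> (\<integral>x. 1 / real n \<partial>P)"
      by (intro integral_mono integrable_abs Bochner_Integration.integrable_diff i iS S \<open>n > 0\<close>) simp
    finally show "\<bar>(\<integral>x. f x \<partial>P) - (\<integral>x. S n x \<partial>P)\<bar> \<le> 1 / real n"
      using i iS by (simp add: P.prob_space)
    show "(\<integral>x. S n x \<partial>P) = (\<Sum>k<n. measure P (F n k)) / real n"
      unfolding S_def using iF by (simp add: Bochner_Integration.integral_sum sp)
  qed
  have "\<bar>(\<integral>x. f x \<partial>M) - (\<integral>x. f x \<partial>N)\<bar> \<le> K + 2 * (1 / real n)" if "n > 0" for n
  proof -
    have "\<bar>(\<Sum>k<n. measure M (F n k)) - (\<Sum>k<n. measure N (F n k))\<bar> \<le> (\<Sum>k<n. \<bar>measure M (F n k) - measure N (F n k)\<bar>)"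
      unfolding sum_subtractf[symmetric] by (rule sum_abs)
    also have "\<dots> \<le> (\<Sum>k<n. K)" by (intro sum_mono le) simp
    finally have "\<bar>(\<integral>x. S n x \<partial>M) - (\<integral>x. S n x \<partial>N)\<bar> \<le> K"
      using that assms(1,2) M N
      by (simp add: int_S abs_divide field_simps flip: diff_divide_distrib)
    then show ?thesis
      using near[OF assms(1) M that] near[OF assms(2) N that] by linarith
  qed
  then have "\<bar>(\<integral>x. f x \<partial>M) - (\<integral>x. f x \<partial>N)\<bar> \<le> K + 2 * (1 / real (Suc n))" for n
    by blast
  moreover have "(\<lambda>n. K + 2 * (1 / real (Suc n))) \<longlonglongrightarrow> K + 2 * 0"
    using LIMSEQ_inverse_real_of_nat by (intro tendsto_intros) (simp add: inverse_eq_divide)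
  ultimately show ?thesis
    by (intro LIMSEQ_le_const[of "\<lambda>n. K + 2 * (1 / real (Suc n))"]) auto
qed

section \<open>The subordinated Wiener process\<close>

text \<open>The setting of the noise alone, before any equation. The subordinated process is spelled
  out in \<open>indep_Y\<xi>\<close> because \<open>Y\<close> is only defined inside the
  locale.\<close>

locale subordinated_wiener_plus_levy =
  fixes N :: "'v measure" and W \<xi> :: "real \<Rightarrow> 'v \<Rightarrow> 'a::euclidean_space" and T :: "real \<Rightarrow> 'v \<Rightarrow> real"
  assumes W: "wiener_process N W"
    and T: "subordinator N T"
    and indep_WT: "indep_processes N W T"
    and \<xi>: "levy_process N \<xi>"
    and indep_Y\<xi>: "indep_processes N (\<lambda>t \<omega>. W (T t \<omega>) \<omega>) \<xi>"
begin

sublocale prob_space N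
  using \<xi> by (simp add: levy_process_def)

sublocale N_lborel: pair_sigma_finite N lborel
  by unfold_locales

sublocale N_N: pair_sigma_finite N N
  by unfold_locales

definition Y :: "real \<Rightarrow> 'v \<Rightarrow> 'a" where "Y t \<omega> = W (T t \<omega>) \<omega>"

definition Z :: "real \<Rightarrow> 'v \<Rightarrow> 'a" where "Z t \<omega> = Y t \<omega> + \<xi> t \<omega>"

section \<open>Measurability and positivity of the ingredients\<close>

lemma W_measurable: "0 \<le> t \<Longrightarrow> W t \<in> borel_measurable N"
  using W by (simp add: wiener_process_def levy_process_measurable)

lemma T_measurable: "0 \<le> t \<Longrightarrow> T t \<in> borel_measurable N"
  using T by (simp add: subordinator_def levy_process_measurable)

lemma \<xi>_measurable: "0 \<le> t \<Longrightarrow> \<xi> t \<in> borel_measurable N"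
  by (rule levy_process_measurable[OF \<xi>])

text \<open>Evaluation of \<open>W\<close> at a random time is not covered by measurability at fixed
  times; the fact comes from \<open>indep_processes\<close>, which includes measurability of both
  processes.\<close>

lemma Y_measurable: "0 \<le> t \<Longrightarrow> Y t \<in> borel_measurable N"
  using indep_Y\<xi> unfolding Y_def by (simp add: indep_processes_def)

lemma Z_measurable: "0 \<le> t \<Longrightarrow> Z t \<in> borel_measurable N"
  unfolding Z_def by (intro borel_measurable_add Y_measurable \<xi>_measurable)

lemma AE_T_pos: "0 < t \<Longrightarrow> AE \<omega> in N. 0 < T t \<omega>"
  using T by (auto simp: subordinator_def elim: eventually_mono)

text \<open>Conditionally on \<open>T\<close>, the law of \<open>Y t\<close> is Gaussian with
  variance \<open>T t\<close>. Continuity of \<open>g\<close> is what lets the limit over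
  discretised times pass through \<open>g\<close>.\<close>

lemma nn_integral_Y_continuous:
  fixes g :: "'a \<Rightarrow> real"
  assumes t: "0 < t" and g: "continuous_on UNIV g" "\<And>x. 0 \<le> g x" "\<And>x. g x \<le> 1"
  shows "(\<integral>\<^sup>+\<omega>. g (Y t \<omega>) \<partial>N) = (\<integral>\<^sup>+\<omega>. \<integral>\<^sup>+v. g v * ennreal (gauss_density (T t \<omega>) v) \<partial>lborel \<partial>N)"
proof -
  have [measurable]: "g \<in> borel_measurable borel" using g by (intro borel_measurable_continuous_onI)
  have [measurable]: "T t \<in> borel_measurable N" "Y t \<in> borel_measurable N"
    using t by (auto intro: T_measurable Y_measurable)
  have g1: "ennreal (g x) \<le> 1" for x using g by simp
  have contW: "AE \<omega> in N. continuous_on UNIV (\<lambda>t. W t \<omega>)"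
    using W by (simp add: wiener_process_def)
  define H where "H r = (\<integral>\<^sup>+\<omega>. g (W r \<omega>) \<partial>N)" for r
  define G where "G r = (\<integral>\<^sup>+v. g v * ennreal (gauss_density r v) \<partial>lborel)" for r
  have [measurable]: "G \<in> borel_measurable borel" unfolding G_def by measurable
  have HG: "H r = G r" if "r > 0" for r
    unfolding H_def G_def by (rule nn_integral_wiener_process[OF W that]) measurable
  have G1: "G r \<le> 1" if "r > 0" for r
  proof -
    have "H r \<le> (\<integral>\<^sup>+\<omega>. 1 \<partial>N)" unfolding H_def by (intro nn_integral_mono g1)
    then show ?thesis using HG[OF that] by (simp add: emeasure_space_1)
  qed
  \<comment> \<open>Continuity of \<open>G\<close> on positive variances is obtained through its
    probabilistic form \<open>H\<close>, by path continuity and dominated convergence.\<close>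
  have G_lim: "(\<lambda>j. G (r j)) \<longlonglongrightarrow> G q" if r: "r \<longlonglongrightarrow> q" "\<And>j. r j > 0" "q > 0" for r q
  proof -
    have [measurable]: "W (r j) \<in> borel_measurable N" "W q \<in> borel_measurable N" for j
      using r by (auto intro!: W_measurable less_imp_le)
    have "(\<lambda>j. \<integral>\<^sup>+\<omega>. g (W (r j) \<omega>) \<partial>N) \<longlonglongrightarrow> (\<integral>\<^sup>+\<omega>. g (W q \<omega>) \<partial>N)"
    proof (rule nn_integral_dominated_convergence[where w="\<lambda>_. 1"])
      show "AE \<omega> in N. (\<lambda>j. ennreal (g (W (r j) \<omega>))) \<longlonglongrightarrow> ennreal (g (W q \<omega>))"
        using contW
      proof eventually_elim
        case (elim \<omega>)
        have "(\<lambda>j. W (r j) \<omega>) \<longlonglongrightarrow> W q \<omega>"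
          by (rule continuous_on_tendsto_compose[OF elim r(1)]) auto
        then have "(\<lambda>j. g (W (r j) \<omega>)) \<longlonglongrightarrow> g (W q \<omega>)"
          by (rule continuous_on_tendsto_compose[OF g(1)]) auto
        then show ?case by (rule tendsto_ennrealI)
      qed
    qed (use g1 in \<open>auto simp: emeasure_space_1\<close>)
    then show ?thesis using r HG by (simp add: H_def)
  qed
  \<comment> \<open>Discretise the random time from above: a countably valued time can be decoupled from \<open>W\<close>
    by independence, and path continuity removes the discretisation.\<close>
  define Tn where "Tn n \<omega> = (real (nat \<lfloor>real (Suc n) * T t \<omega>\<rfloor>) + 1) / real (Suc n)" for n \<omega>
  \<comment> \<open>The added one makes this hold for every \<open>\<omega>\<close>: even where
    \<open>T t \<omega>\<close> is not positive, \<open>nat\<close> returns 0 at worst. Hence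
    \<open>HG\<close> always applies at \<open>Tn\<close>.\<close>
  have Tn_pos: "Tn n \<omega> > 0" for n \<omega>
    unfolding Tn_def by (intro divide_pos_pos) linarith+
  have [measurable]: "Tn n \<in> borel_measurable N" for n unfolding Tn_def by measurable
  have Tn_lim: "(\<lambda>n. Tn n \<omega>) \<longlonglongrightarrow> T t \<omega>" if "T t \<omega> > 0" for \<omega>
  proof (rule real_tendsto_sandwich)
    have *: "real (nat \<lfloor>real (Suc n) * T t \<omega>\<rfloor>) = of_int \<lfloor>real (Suc n) * T t \<omega>\<rfloor>" for n
      using that by simp
    show "eventually (\<lambda>n. T t \<omega> \<le> Tn n \<omega>) sequentially"
    proof (rule always_eventually, rule allI)
      fix n
      have "real (Suc n) * T t \<omega> \<le> real (nat \<lfloor>real (Suc n) * T t \<omega>\<rfloor>) + 1"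
        unfolding * by linarith
      then show "T t \<omega> \<le> Tn n \<omega>" unfolding Tn_def by (subst pos_le_divide_eq) (simp_all add: mult.commute)
    qed
    show "eventually (\<lambda>n. Tn n \<omega> \<le> T t \<omega> + 1 / real (Suc n)) sequentially"
    proof (rule always_eventually, rule allI)
      fix n
      have "real (nat \<lfloor>real (Suc n) * T t \<omega>\<rfloor>) + 1 \<le> real (Suc n) * T t \<omega> + 1"
        unfolding * by linarith
      then have "Tn n \<omega> \<le> (real (Suc n) * T t \<omega> + 1) / real (Suc n)"
        unfolding Tn_def by (rule divide_right_mono) simp
      then show "Tn n \<omega> \<le> T t \<omega> + 1 / real (Suc n)" by (simp add: add_divide_distrib)
    qed
    show "(\<lambda>n. T t \<omega> + 1 / real (Suc n)) \<longlonglongrightarrow> T t \<omega>"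
      using tendsto_add[OF tendsto_const LIMSEQ_inverse_real_of_nat, of "T t \<omega>"]
      by (simp add: inverse_eq_divide)
  qed simp
  define J where "J n k = {\<tau>::real. nat \<lfloor>real (Suc n) * \<tau>\<rfloor> = k}" for n k
  have [measurable]: "J n k \<in> sets borel" for n k unfolding J_def by measurable
  define c where "c n k = (real k + 1) / real (Suc n)" for n k
  have c_pos: "c n k > 0" for n k by (auto simp: c_def intro!: divide_pos_pos)
  have [measurable]: "W (c n k) \<in> borel_measurable N" for n k
    by (intro W_measurable less_imp_le c_pos)
  \<comment> \<open>Exactly one term of the series is nonzero. Only deterministic times occur on the
    right, which yields both measurability and the decoupling by independence term by term.\<close>
  have split: "\<phi> (Tn n \<omega>) = (\<Sum>k. indicator (J n k) (T t \<omega>) * \<phi> (c n k))" for n \<omega> and \<phi> :: "real \<Rightarrow> ennreal"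
  proof -
    have "(\<Sum>k. indicator (J n k) (T t \<omega>) * \<phi> (c n k))
      = (\<Sum>k\<in>{nat \<lfloor>real (Suc n) * T t \<omega>\<rfloor>}. indicator (J n k) (T t \<omega>) * \<phi> (c n k))"
      by (rule suminf_finite) (auto simp: J_def)
    then show ?thesis by (simp add: J_def Tn_def c_def)
  qed
  have meas: "(\<lambda>\<omega>. ennreal (g (W (Tn n \<omega>) \<omega>))) \<in> borel_measurable N" for n
    unfolding split[of "\<lambda>r. ennreal (g (W r _))"] by measurable
  have eq: "(\<integral>\<^sup>+\<omega>. g (W (Tn n \<omega>) \<omega>) \<partial>N) = (\<integral>\<^sup>+\<omega>. G (Tn n \<omega>) \<partial>N)" for n
  proof -
    have "(\<integral>\<^sup>+\<omega>. g (W (Tn n \<omega>) \<omega>) \<partial>N) = (\<Sum>k. \<integral>\<^sup>+\<omega>. indicator (J n k) (T t \<omega>) * ennreal (g (W (c n k) \<omega>)) \<partial>N)"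
      unfolding split[of "\<lambda>r. ennreal (g (W r _))"] by (rule nn_integral_suminf) measurable
    also have "\<dots> = (\<Sum>k. \<integral>\<^sup>+\<omega>. indicator (J n k) (T t \<omega>) * G (c n k) \<partial>N)"
    proof (rule suminf_cong)
      fix k
      have "(\<integral>\<^sup>+\<omega>. indicator (J n k) (T t \<omega>) * ennreal (g (W (c n k) \<omega>)) \<partial>N)
        = (\<integral>\<^sup>+\<omega>. \<integral>\<^sup>+\<omega>'. indicator (J n k) (T t \<omega>') * ennreal (g (W (c n k) \<omega>)) \<partial>N \<partial>N)"
        using nn_integral_indep_processes[OF indep_WT, of "c n k" t "\<lambda>(w, \<tau>). indicator (J n k) \<tau> * ennreal (g w)"] t c_pos[of n k]
        by simp
      also have "\<dots> = (\<integral>\<^sup>+\<omega>'. \<integral>\<^sup>+\<omega>. indicator (J n k) (T t \<omega>') * ennreal (g (W (c n k) \<omega>)) \<partial>N \<partial>N)"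
        by (rule N_N.Fubini') measurable
      also have "\<dots> = (\<integral>\<^sup>+\<omega>'. indicator (J n k) (T t \<omega>') * G (c n k) \<partial>N)"
        unfolding HG[OF c_pos, symmetric] H_def by (intro nn_integral_cong nn_integral_cmult) measurable
      finally show "(\<integral>\<^sup>+\<omega>. indicator (J n k) (T t \<omega>) * ennreal (g (W (c n k) \<omega>)) \<partial>N)
        = (\<integral>\<^sup>+\<omega>. indicator (J n k) (T t \<omega>) * G (c n k) \<partial>N)" .
    qed
    also have "\<dots> = (\<integral>\<^sup>+\<omega>. G (Tn n \<omega>) \<partial>N)"
      unfolding split[of G] by (rule nn_integral_suminf[symmetric]) measurable
    finally show ?thesis .
  qed
  have "(\<lambda>n. \<integral>\<^sup>+\<omega>. g (W (Tn n \<omega>) \<omega>) \<partial>N) \<longlonglongrightarrow> (\<integral>\<^sup>+\<omega>. g (Y t \<omega>) \<partial>N)"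
  proof (rule nn_integral_dominated_convergence[where w="\<lambda>_. 1"])
    show "AE \<omega> in N. (\<lambda>n. ennreal (g (W (Tn n \<omega>) \<omega>))) \<longlonglongrightarrow> ennreal (g (Y t \<omega>))"
      using contW AE_T_pos[OF t]
    proof eventually_elim
      case (elim \<omega>)
      have "(\<lambda>n. W (Tn n \<omega>) \<omega>) \<longlonglongrightarrow> W (T t \<omega>) \<omega>"
        by (rule continuous_on_tendsto_compose[OF elim(1) Tn_lim[OF elim(2)]]) auto
      then have "(\<lambda>n. g (W (Tn n \<omega>) \<omega>)) \<longlonglongrightarrow> g (W (T t \<omega>) \<omega>)"
        by (rule continuous_on_tendsto_compose[OF g(1)]) auto
      then show ?case unfolding Y_def by (rule tendsto_ennrealI)
    qed
  qed (use g1 meas in \<open>auto simp: emeasure_space_1\<close>)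
  moreover have "(\<lambda>n. \<integral>\<^sup>+\<omega>. G (Tn n \<omega>) \<partial>N) \<longlonglongrightarrow> (\<integral>\<^sup>+\<omega>. G (T t \<omega>) \<partial>N)"
  proof (rule nn_integral_dominated_convergence[where w="\<lambda>_. 1"])
    show "AE \<omega> in N. (\<lambda>n. G (Tn n \<omega>)) \<longlonglongrightarrow> G (T t \<omega>)"
      using AE_T_pos[OF t] by eventually_elim (intro G_lim Tn_lim Tn_pos)
  qed (use G1 Tn_pos in \<open>auto simp: emeasure_space_1\<close>)
  ultimately have "(\<integral>\<^sup>+\<omega>. g (Y t \<omega>) \<partial>N) = (\<integral>\<^sup>+\<omega>. G (T t \<omega>) \<partial>N)"
    unfolding eq by (rule LIMSEQ_unique)
  then show ?thesis by (simp add: G_def)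
qed

text \<open>Realises the mixture as an actual measure on the state space, so that it can be compared
  with the law of \<open>Y t\<close>; the identity itself is Tonelli.\<close>

lemma nn_integral_gauss_mixture:
  fixes f :: "'a \<Rightarrow> ennreal"
  assumes t: "0 < t" and [measurable]: "f \<in> borel_measurable borel"
  shows "(\<integral>\<^sup>+v. f v \<partial>density lborel (\<lambda>v. \<integral>\<^sup>+\<omega>. ennreal (gauss_density (T t \<omega>) v) \<partial>N))
    = (\<integral>\<^sup>+\<omega>. \<integral>\<^sup>+v. f v * ennreal (gauss_density (T t \<omega>) v) \<partial>lborel \<partial>N)"
proof -
  have [measurable]: "T t \<in> borel_measurable N" using t by (auto intro: T_measurable)
  have "(\<integral>\<^sup>+v. f v \<partial>density lborel (\<lambda>v. \<integral>\<^sup>+\<omega>. ennreal (gauss_density (T t \<omega>) v) \<partial>N))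
    = (\<integral>\<^sup>+v. (\<integral>\<^sup>+\<omega>. ennreal (gauss_density (T t \<omega>) v) \<partial>N) * f v \<partial>lborel)"
    by (rule nn_integral_density) measurable
  also have "\<dots> = (\<integral>\<^sup>+v. \<integral>\<^sup>+\<omega>. f v * ennreal (gauss_density (T t \<omega>) v) \<partial>N \<partial>lborel)"
    by (intro nn_integral_cong) (simp add: nn_integral_cmult mult.commute)
  also have "\<dots> = (\<integral>\<^sup>+\<omega>. \<integral>\<^sup>+v. f v * ennreal (gauss_density (T t \<omega>) v) \<partial>lborel \<partial>N)"
    by (rule N_lborel.Fubini') measurable
  finally show ?thesis .
qed

lemma nn_integral_Y:
  fixes f :: "'a \<Rightarrow> ennreal"
  assumes t: "0 < t" and [measurable]: "f \<in> borel_measurable borel"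
  shows "(\<integral>\<^sup>+\<omega>. f (Y t \<omega>) \<partial>N) = (\<integral>\<^sup>+\<omega>. \<integral>\<^sup>+v. f v * ennreal (gauss_density (T t \<omega>) v) \<partial>lborel \<partial>N)"
proof -
  have [measurable]: "T t \<in> borel_measurable N" "Y t \<in> borel_measurable N"
    using t by (auto intro: T_measurable Y_measurable)
  let ?D = "density lborel (\<lambda>v. \<integral>\<^sup>+\<omega>. ennreal (gauss_density (T t \<omega>) v) \<partial>N) :: 'a measure"
  \<comment> \<open>Finiteness of the mixture is needed for the uniqueness criterion; almost surely
    the variance is positive and the inner integral is one.\<close>
  have "emeasure ?D UNIV = (\<integral>\<^sup>+v. 1 \<partial>?D)" by simp
  also have "\<dots> = (\<integral>\<^sup>+\<omega>. \<integral>\<^sup>+v. ennreal (gauss_density (T t \<omega>) (v::'a)) \<partial>lborel \<partial>N)"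
    by (subst nn_integral_gauss_mixture[OF t]) simp_all
  also have "\<dots> = (\<integral>\<^sup>+\<omega>. 1 \<partial>N)"
    using AE_T_pos[OF t]
    by (intro nn_integral_cong_AE) (auto elim!: eventually_mono simp: wiener_process_gauss_density_norm[OF W])
  finally have D1: "emeasure ?D UNIV = 1" by (simp add: emeasure_space_1)
  have "distr N borel (Y t) = ?D"
  proof (rule finite_measure_eqI_continuous)
    show "finite_measure (distr N borel (Y t))" by (rule finite_measure_distr) simp
    show "finite_measure ?D" by (rule finite_measureI) (simp add: D1)
    fix g :: "'a \<Rightarrow> real" assume g: "continuous_on UNIV g" "\<And>x. 0 \<le> g x" "\<And>x. g x \<le> 1"
    then have [measurable]: "g \<in> borel_measurable borel" by (intro borel_measurable_continuous_onI)
    have "(\<integral>\<^sup>+x. g x \<partial>distr N borel (Y t)) = (\<integral>\<^sup>+x. g x \<partial>?D)"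
      using nn_integral_Y_continuous[OF t g] by (simp add: nn_integral_distr nn_integral_gauss_mixture[OF t])
    then show "(\<integral>x. g x \<partial>distr N borel (Y t)) = (\<integral>x. g x \<partial>?D)"
      using g by (subst (1 2) integral_eq_nn_integral) auto
  qed simp_all
  then have "(\<integral>\<^sup>+x. f x \<partial>distr N borel (Y t)) = (\<integral>\<^sup>+x. f x \<partial>?D)" by simp
  then show ?thesis by (simp add: nn_integral_distr nn_integral_gauss_mixture[OF t])
qed

end

section \<open>Convolution semigroup and smoothing\<close>

text \<open>On each cell a decreasing function is at least its value at the right end. Right
  endpoints also keep the sum away from 0, where \<rho> may blow up.\<close>

lemma sum_le_integral_antimono:
  fixes \<rho> :: "real \<Rightarrow> real"
  assumes int: "integrable lborel (\<lambda>s. indicator {0<..\<delta>} s * \<rho> s)"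
    and anti: "\<And>s t. 0 < s \<Longrightarrow> s \<le> t \<Longrightarrow> \<rho> t \<le> \<rho> s" and d: "d > 0" and n: "real n * d \<le> \<delta>"
  shows "d * (\<Sum>j<n. \<rho> (real (Suc j) * d)) \<le> (\<integral>s. indicator {0<..real n * d} s * \<rho> s \<partial>lborel)"
  using n
proof (induction n)
  case (Suc n)
  define a where "a = real n * d"
  have a: "0 \<le> a" "a + d \<le> \<delta>" "real (Suc n) * d = a + d"
    using d Suc.prems by (auto simp: a_def algebra_simps)
  have sub: "integrable lborel (\<lambda>s. indicator A s * \<rho> s)" if "A \<in> sets borel" "A \<subseteq> {0<..\<delta>}" for A
  proof -
    have "integrable lborel (\<lambda>s. indicator A s *\<^sub>R (indicator {0<..\<delta>} s * \<rho> s))"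
      using int that by (intro integrable_mult_indicator) auto
    also have "(\<lambda>s. indicator A s *\<^sub>R (indicator {0<..\<delta>} s * \<rho> s)) = (\<lambda>s. indicator A s * \<rho> s)"
      using that by (auto simp: fun_eq_iff indicator_def)
    finally show ?thesis .
  qed
  have "d * \<rho> (a + d) = (\<integral>s. indicator {a<..a + d} s * \<rho> (a + d) \<partial>lborel)"
    using d by simp
  also have "\<dots> \<le> (\<integral>s. indicator {a<..a + d} s * \<rho> s \<partial>lborel)"
  proof (rule integral_mono)
    show "integrable lborel (\<lambda>s. indicator {a<..a + d} s * \<rho> (a + d))"
      using d by (intro integrable_mult_left integrable_real_indicator) auto
    show "integrable lborel (\<lambda>s. indicator {a<..a + d} s * \<rho> s)"
      using a by (intro sub) auto
  qed (use a d in \<open>auto simp: indicator_def intro!: anti\<close>)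
  finally have 1: "d * \<rho> (a + d) \<le> (\<integral>s. indicator {a<..a + d} s * \<rho> s \<partial>lborel)" .
  have "(\<integral>s. indicator {0<..a + d} s * \<rho> s \<partial>lborel)
    = (\<integral>s. indicator {0<..a} s * \<rho> s + indicator {a<..a + d} s * \<rho> s \<partial>lborel)"
    using a d by (intro Bochner_Integration.integral_cong) (auto simp: indicator_def)
  also have "\<dots> = (\<integral>s. indicator {0<..a} s * \<rho> s \<partial>lborel) + (\<integral>s. indicator {a<..a + d} s * \<rho> s \<partial>lborel)"
    using a d by (intro Bochner_Integration.integral_add sub) auto
  finally have 2: "(\<integral>s. indicator {0<..a + d} s * \<rho> s \<partial>lborel)
    = (\<integral>s. indicator {0<..a} s * \<rho> s \<partial>lborel) + (\<integral>s. indicator {a<..a + d} s * \<rho> s \<partial>lborel)" .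
  have "d * (\<Sum>j<n. \<rho> (real (Suc j) * d)) \<le> (\<integral>s. indicator {0<..a} s * \<rho> s \<partial>lborel)"
    unfolding a_def using Suc.prems d by (intro Suc.IH) (simp add: algebra_simps)
  then show ?case
    using 1 2 unfolding a(3) sum.lessThan_Suc by (simp add: a(3) distrib_left)
qed simp

section \<open>Convolution property and spatial smoothing of the noise\<close>

context subordinated_wiener_plus_levy
begin

text \<open>In the mixture representation, Gaussian convolution replaces the variances by
  \<open>T s \<omega> + T t \<omega>'\<close> with independent copies, and the Levy property of
  \<open>T\<close> turns this into \<open>T (s + t)\<close>.\<close>

lemma nn_integral_Y_add:
  fixes f :: "'a \<Rightarrow> ennreal"
  assumes s: "0 < s" and t: "0 < t" and [measurable]: "f \<in> borel_measurable borel"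
  shows "(\<integral>\<^sup>+\<omega>. f (Y (s + t) \<omega>) \<partial>N) = (\<integral>\<^sup>+\<omega>. \<integral>\<^sup>+\<omega>'. f (Y s \<omega> + Y t \<omega>') \<partial>N \<partial>N)"
proof -
  have [measurable]: "T s \<in> borel_measurable N" "T t \<in> borel_measurable N" "Y s \<in> borel_measurable N" "Y t \<in> borel_measurable N"
    using s t by (auto intro: T_measurable Y_measurable)
  define G where "G r = (\<integral>\<^sup>+v. f v * ennreal (gauss_density r v) \<partial>lborel)" for r
  have [measurable]: "G \<in> borel_measurable borel" unfolding G_def by measurable
  define h where "h u r = (\<integral>\<^sup>+v. f (u + v) * ennreal (gauss_density r v) \<partial>lborel)" for u r
  have [measurable]: "(\<lambda>(u, r). h u r) \<in> borel_measurable (borel \<Otimes>\<^sub>M borel)" unfolding h_def by measurable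
  have "(\<integral>\<^sup>+\<omega>. \<integral>\<^sup>+\<omega>'. f (Y s \<omega> + Y t \<omega>') \<partial>N \<partial>N) = (\<integral>\<^sup>+\<omega>. \<integral>\<^sup>+\<omega>'. h (Y s \<omega>) (T t \<omega>') \<partial>N \<partial>N)"
    unfolding h_def using nn_integral_Y[OF t, of "\<lambda>v. f (Y s _ + v)"] by simp
  also have "\<dots> = (\<integral>\<^sup>+\<omega>. \<integral>\<^sup>+u. (\<integral>\<^sup>+\<omega>'. h u (T t \<omega>') \<partial>N) * ennreal (gauss_density (T s \<omega>) u) \<partial>lborel \<partial>N)"
    by (rule nn_integral_Y[OF s, of "\<lambda>u. \<integral>\<^sup>+\<omega>'. h u (T t \<omega>') \<partial>N"]) measurable
  also have "\<dots> = (\<integral>\<^sup>+\<omega>. \<integral>\<^sup>+u. \<integral>\<^sup>+\<omega>'. h u (T t \<omega>') * ennreal (gauss_density (T s \<omega>) u) \<partial>N \<partial>lborel \<partial>N)"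
    by (intro nn_integral_cong nn_integral_multc[symmetric]) measurable
  also have "\<dots> = (\<integral>\<^sup>+\<omega>. \<integral>\<^sup>+\<omega>'. \<integral>\<^sup>+u. h u (T t \<omega>') * ennreal (gauss_density (T s \<omega>) u) \<partial>lborel \<partial>N \<partial>N)"
    by (intro nn_integral_cong N_lborel.Fubini') measurable
  also have "\<dots> = (\<integral>\<^sup>+\<omega>. \<integral>\<^sup>+\<omega>'. G (T s \<omega> + T t \<omega>') \<partial>N \<partial>N)"
  proof (rule nn_integral_cong_AE, use AE_T_pos[OF s] in eventually_elim)
    fix \<omega> assume "0 < T s \<omega>"
    then show "(\<integral>\<^sup>+\<omega>'. \<integral>\<^sup>+u. h u (T t \<omega>') * ennreal (gauss_density (T s \<omega>) u) \<partial>lborel \<partial>N) = (\<integral>\<^sup>+\<omega>'. G (T s \<omega> + T t \<omega>') \<partial>N)"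
      using AE_T_pos[OF t]
      by (intro nn_integral_cong_AE) (auto elim!: eventually_mono simp: G_def h_def gauss_density_add[OF W])
  qed
  also have "\<dots> = (\<integral>\<^sup>+\<omega>. G (T (s + t) \<omega>) \<partial>N)"
    using T s t by (intro nn_integral_levy_process_add[symmetric]) (auto simp: subordinator_def)
  also have "\<dots> = (\<integral>\<^sup>+\<omega>. f (Y (s + t) \<omega>) \<partial>N)"
    unfolding G_def using s t by (intro nn_integral_Y[symmetric]) auto
  finally show ?thesis by simp
qed

lemma nn_integral_Z:
  fixes f :: "'a \<Rightarrow> ennreal"
  assumes t: "0 < t" and [measurable]: "f \<in> borel_measurable borel"
  shows "(\<integral>\<^sup>+\<omega>. f (Z t \<omega>) \<partial>N) = (\<integral>\<^sup>+\<omega>. \<integral>\<^sup>+\<omega>'. f (Y t \<omega> + \<xi> t \<omega>') \<partial>N \<partial>N)"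
  using nn_integral_indep_processes[OF indep_Y\<xi>, of t t "\<lambda>(x, y). f (x + y)"] t
  by (simp add: Z_def Y_def)

text \<open>The one-dimensional laws of \<open>Y\<close> and \<xi> both have the convolution
  property and are independent, so the four integrals can be regrouped.\<close>

lemma nn_integral_Z_add:
  fixes f :: "'a \<Rightarrow> ennreal"
  assumes s: "0 < s" and t: "0 < t" and [measurable]: "f \<in> borel_measurable borel"
  shows "(\<integral>\<^sup>+\<omega>. f (Z (s + t) \<omega>) \<partial>N) = (\<integral>\<^sup>+\<omega>. \<integral>\<^sup>+\<omega>'. f (Z s \<omega> + Z t \<omega>') \<partial>N \<partial>N)"
proof -
  have [measurable]: "Y s \<in> borel_measurable N" "Y t \<in> borel_measurable N" "Y (s + t) \<in> borel_measurable N"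
    "\<xi> s \<in> borel_measurable N" "\<xi> t \<in> borel_measurable N" "\<xi> (s + t) \<in> borel_measurable N"
    "Z s \<in> borel_measurable N" "Z t \<in> borel_measurable N"
    using s t by (auto intro: \<xi>_measurable Y_measurable Z_measurable)
  have "(\<integral>\<^sup>+\<omega>. f (Z (s + t) \<omega>) \<partial>N) = (\<integral>\<^sup>+\<omega>. \<integral>\<^sup>+\<omega>'. f (Y (s + t) \<omega> + \<xi> (s + t) \<omega>') \<partial>N \<partial>N)"
    using s t by (intro nn_integral_Z) auto
  also have "\<dots> = (\<integral>\<^sup>+\<omega>. \<integral>\<^sup>+\<eta>. \<integral>\<^sup>+\<eta>'. f (Y (s + t) \<omega> + (\<xi> s \<eta> + \<xi> t \<eta>')) \<partial>N \<partial>N \<partial>N)"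
    by (intro nn_integral_cong nn_integral_levy_process_add[OF \<xi> s t, of "\<lambda>x. f (Y (s + t) _ + x)"]) measurable
  also have "\<dots> = (\<integral>\<^sup>+\<omega>. \<integral>\<^sup>+\<omega>'. \<integral>\<^sup>+\<eta>. \<integral>\<^sup>+\<eta>'. f (Y s \<omega> + Y t \<omega>' + (\<xi> s \<eta> + \<xi> t \<eta>')) \<partial>N \<partial>N \<partial>N \<partial>N)"
    by (rule nn_integral_Y_add[OF s t, of "\<lambda>y. \<integral>\<^sup>+\<eta>. \<integral>\<^sup>+\<eta>'. f (y + (\<xi> s \<eta> + \<xi> t \<eta>')) \<partial>N \<partial>N"]) measurable
  \<comment> \<open>Exchanging the two middle integrals pairs \<open>Y s\<close> with
    \<open>\<xi> s\<close> and \<open>Y t\<close> with \<open>\<xi> t\<close>.\<close>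
  also have "\<dots> = (\<integral>\<^sup>+\<omega>. \<integral>\<^sup>+\<eta>. \<integral>\<^sup>+\<omega>'. \<integral>\<^sup>+\<eta>'. f ((Y s \<omega> + \<xi> s \<eta>) + (Y t \<omega>' + \<xi> t \<eta>')) \<partial>N \<partial>N \<partial>N \<partial>N)"
    by (subst N_N.Fubini') (simp_all add: ac_simps)
  also have "\<dots> = (\<integral>\<^sup>+\<omega>. \<integral>\<^sup>+\<eta>. \<integral>\<^sup>+\<omega>'. f ((Y s \<omega> + \<xi> s \<eta>) + Z t \<omega>') \<partial>N \<partial>N \<partial>N)"
    by (intro nn_integral_cong nn_integral_Z[OF t, of "\<lambda>x. f (Y s _ + \<xi> s _ + x)", symmetric]) measurable
  also have "\<dots> = (\<integral>\<^sup>+\<omega>. \<integral>\<^sup>+\<omega>'. f (Z s \<omega> + Z t \<omega>') \<partial>N \<partial>N)"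
    by (rule nn_integral_Z[OF s, of "\<lambda>x. \<integral>\<^sup>+\<omega>'. f (x + Z t \<omega>') \<partial>N", symmetric]) measurable
  finally show ?thesis .
qed

text \<open>Valued in \<open>ennreal\<close> because finiteness is not known beforehand. At time 0
  division by zero makes the value 0, which concerns a single point of the time integral.\<close>

definition inv_moment :: "real \<Rightarrow> ennreal" where
  "inv_moment t = (\<integral>\<^sup>+\<omega>. ennreal (1 / sqrt (T t \<omega>)) \<partial>N)"

text \<open>Conditionally on \<xi> and \<open>T\<close> this is the Gaussian shift estimate. Its
  bound does not see the extra shift by \<xi>, so only the integral of
  \<open>1 / sqrt (T t \<omega>)\<close> remains.\<close>

lemma nn_integral_Z_shift_le:
  fixes g :: "'a \<Rightarrow> ennreal"
  assumes t: "0 < t" and [measurable]: "g \<in> borel_measurable borel" and g1: "\<And>v. g v \<le> 1"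
  shows "(\<integral>\<^sup>+\<omega>. g (x + Z t \<omega>) \<partial>N) \<le> (\<integral>\<^sup>+\<omega>. g (y + Z t \<omega>) \<partial>N) + ennreal (dist x y) * inv_moment t"
proof -
  have [measurable]: "Y t \<in> borel_measurable N" "\<xi> t \<in> borel_measurable N" "T t \<in> borel_measurable N"
    using t by (auto intro: \<xi>_measurable Y_measurable T_measurable)
  define K where "K c \<omega> = (\<integral>\<^sup>+v. g (c + v) * ennreal (gauss_density (T t \<omega>) v) \<partial>lborel)" for c \<omega>
  have [measurable]: "(\<lambda>(c, \<omega>). K c \<omega>) \<in> borel_measurable (borel \<Otimes>\<^sub>M N)"
    unfolding K_def by measurable
  have eq: "(\<integral>\<^sup>+\<omega>. g (c + Z t \<omega>) \<partial>N) = (\<integral>\<^sup>+\<eta>. \<integral>\<^sup>+\<omega>. K (c + \<xi> t \<eta>) \<omega> \<partial>N \<partial>N)" for c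
  proof -
    have "(\<integral>\<^sup>+\<omega>. g (c + Z t \<omega>) \<partial>N) = (\<integral>\<^sup>+\<omega>. \<integral>\<^sup>+\<eta>. g (c + (Y t \<omega> + \<xi> t \<eta>)) \<partial>N \<partial>N)"
      by (rule nn_integral_Z[OF t, of "\<lambda>z. g (c + z)"]) measurable
    also have "\<dots> = (\<integral>\<^sup>+\<eta>. \<integral>\<^sup>+\<omega>. g (c + \<xi> t \<eta> + Y t \<omega>) \<partial>N \<partial>N)"
      by (subst N_N.Fubini') (simp_all add: ac_simps)
    also have "\<dots> = (\<integral>\<^sup>+\<eta>. \<integral>\<^sup>+\<omega>. K (c + \<xi> t \<eta>) \<omega> \<partial>N \<partial>N)"
      unfolding K_def by (intro nn_integral_cong nn_integral_Y[OF t, of "\<lambda>z. g (c + \<xi> t _ + z)"]) measurable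
    finally show ?thesis .
  qed
  have le: "(\<integral>\<^sup>+\<omega>. K (x + c) \<omega> \<partial>N) \<le> (\<integral>\<^sup>+\<omega>. K (y + c) \<omega> \<partial>N) + ennreal (dist x y) * inv_moment t" for c
  proof -
    have "(\<integral>\<^sup>+\<omega>. K (x + c) \<omega> \<partial>N) \<le> (\<integral>\<^sup>+\<omega>. K (y + c) \<omega> + ennreal (dist x y) * ennreal (1 / sqrt (T t \<omega>)) \<partial>N)"
    proof (rule nn_integral_mono_AE, use AE_T_pos[OF t] in eventually_elim)
      fix \<omega> assume "0 < T t \<omega>"
      then show "K (x + c) \<omega> \<le> K (y + c) \<omega> + ennreal (dist x y) * ennreal (1 / sqrt (T t \<omega>))"
        unfolding K_def
        using gauss_density_shift_le[OF _ wiener_process_gauss_density_norm[OF W], of "T t \<omega>" g "x + c" "y + c"] g1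
        by (simp add: dist_norm ennreal_mult[symmetric])
    qed
    also have "\<dots> = (\<integral>\<^sup>+\<omega>. K (y + c) \<omega> \<partial>N) + ennreal (dist x y) * inv_moment t"
      unfolding inv_moment_def by (subst nn_integral_add) (auto simp: nn_integral_cmult)
    finally show ?thesis .
  qed
  have "(\<integral>\<^sup>+\<omega>. g (x + Z t \<omega>) \<partial>N) \<le> (\<integral>\<^sup>+\<eta>. (\<integral>\<^sup>+\<omega>. K (y + \<xi> t \<eta>) \<omega> \<partial>N) + ennreal (dist x y) * inv_moment t \<partial>N)"
    unfolding eq by (intro nn_integral_mono le)
  also have "\<dots> = (\<integral>\<^sup>+\<omega>. g (y + Z t \<omega>) \<partial>N) + ennreal (dist x y) * inv_moment t"
    unfolding eq by (subst nn_integral_add) (auto simp: emeasure_space_1)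
  finally show ?thesis .
qed

text \<open>Paths of \<open>T\<close> increase; positivity of \<open>T s\<close> excludes the case
  in which division by zero would reverse the inequality.\<close>

lemma inv_moment_antimono:
  assumes "0 < s" "s \<le> t"
  shows "inv_moment t \<le> inv_moment s"
  unfolding inv_moment_def
proof (rule nn_integral_mono_AE)
  have "AE \<omega> in N. mono_on {0..} (\<lambda>t. T t \<omega>)"
    using T by (auto simp: subordinator_def)
  then show "AE \<omega> in N. ennreal (1 / sqrt (T t \<omega>)) \<le> ennreal (1 / sqrt (T s \<omega>))"
    using AE_T_pos[OF \<open>0 < s\<close>]
  proof eventually_elim
    case (elim \<omega>)
    have "T s \<omega> \<le> T t \<omega>" using elim(1) assms by (auto simp: mono_on_def)
    then show ?case using elim(2) by (intro ennreal_leI divide_left_mono) auto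
  qed
qed

end

section \<open>The semigroup of the noise\<close>

context subordinated_wiener_plus_levy
begin

text \<open>\<open>enn2real\<close> sends infinity to 0, so \<rho> is a valid Lipschitz constant
  only where the moment is finite.\<close>

definition \<rho> :: "real \<Rightarrow> real" where "\<rho> t = enn2real (inv_moment t)"

definition PZ :: "real \<Rightarrow> ('a \<Rightarrow> real) \<Rightarrow> 'a \<Rightarrow> real" where
  "PZ t f x = (\<integral>\<omega>. f (x + Z t \<omega>) \<partial>N)"

lemma PZ_measurable:
  assumes [measurable]: "f \<in> borel_measurable borel" and "0 \<le> t"
  shows "PZ t f \<in> borel_measurable borel"
proof -
  have [measurable]: "Z t \<in> borel_measurable N" using \<open>0 \<le> t\<close> by (rule Z_measurable)
  show ?thesis unfolding PZ_def by measurable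
qed

lemma ennreal_PZ:
  assumes [measurable]: "f \<in> borel_measurable borel" and f: "\<And>x. 0 \<le> f x" "\<And>x. f x \<le> 1" and "0 \<le> t"
  shows "ennreal (PZ t f x) = (\<integral>\<^sup>+\<omega>. f (x + Z t \<omega>) \<partial>N)"
proof -
  have [measurable]: "Z t \<in> borel_measurable N" using \<open>0 \<le> t\<close> by (rule Z_measurable)
  have "integrable N (\<lambda>\<omega>. f (x + Z t \<omega>))"
    by (rule integrable_const_bound[where B=1]) (use f in auto)
  then show ?thesis unfolding PZ_def using f by (simp add: nn_integral_eq_integral)
qed

lemma PZ_bounds:
  assumes [measurable]: "f \<in> borel_measurable borel" and f: "\<And>x. 0 \<le> f x" "\<And>x. f x \<le> 1" and "0 \<le> t"
  shows "0 \<le> PZ t f x" "PZ t f x \<le> 1"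
proof -
  show "0 \<le> PZ t f x" unfolding PZ_def using f by simp
  have "(\<integral>\<^sup>+\<omega>. f (x + Z t \<omega>) \<partial>N) \<le> (\<integral>\<^sup>+\<omega>. 1 \<partial>N)"
    by (intro nn_integral_mono) (use f in simp)
  then have "ennreal (PZ t f x) \<le> 1"
    unfolding ennreal_PZ[OF assms] by (simp add: emeasure_space_1)
  then show "PZ t f x \<le> 1" by simp
qed

lemma PZ_add:
  assumes [measurable]: "f \<in> borel_measurable borel" and f: "\<And>x. 0 \<le> f x" "\<And>x. f x \<le> 1"
    and s: "0 < s" and t: "0 < t"
  shows "PZ (s + t) f x = PZ s (PZ t f) x"
proof -
  have [measurable]: "PZ t f \<in> borel_measurable borel" using t by (intro PZ_measurable) auto
  have "ennreal (PZ (s + t) f x) = (\<integral>\<^sup>+\<omega>. f (x + Z (s + t) \<omega>) \<partial>N)"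
    using f s t by (intro ennreal_PZ) auto
  also have "\<dots> = (\<integral>\<^sup>+\<omega>. \<integral>\<^sup>+\<omega>'. f (x + (Z s \<omega> + Z t \<omega>')) \<partial>N \<partial>N)"
    by (rule nn_integral_Z_add[OF s t, of "\<lambda>z. f (x + z)"]) measurable
  also have "\<dots> = (\<integral>\<^sup>+\<omega>. PZ t f (x + Z s \<omega>) \<partial>N)"
    using f t by (intro nn_integral_cong) (simp add: ennreal_PZ add.assoc)
  also have "\<dots> = ennreal (PZ s (PZ t f) x)"
    using f s t by (intro ennreal_PZ[symmetric]) (auto intro!: PZ_bounds)
  finally show ?thesis
    using f s t by (subst (asm) ennreal_inj) (auto intro!: PZ_bounds)
qed

text \<open>The smoothing effect of the noise: the constant depends on the time only, not on
  \<open>f\<close>. Exchanging \<open>x\<close> and \<open>y\<close> turns the one-sided estimate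
  into an absolute one.\<close>

lemma PZ_lipschitz:
  assumes [measurable]: "f \<in> borel_measurable borel" and f: "\<And>x. 0 \<le> f x" "\<And>x. f x \<le> 1"
    and t: "0 < t" and fin: "inv_moment t < \<infinity>"
  shows "\<bar>PZ t f x - PZ t f y\<bar> \<le> \<rho> t * dist x y"
proof -
  have le: "PZ t f x \<le> PZ t f y + \<rho> t * dist x y" for x y
  proof -
    have nonneg: "0 \<le> PZ t f y" using f t by (intro PZ_bounds) auto
    have "ennreal (PZ t f x) \<le> ennreal (PZ t f y) + ennreal (dist x y) * inv_moment t"
      using nn_integral_Z_shift_le[OF t, of "\<lambda>x. ennreal (f x)" x y] f t by (simp add: ennreal_PZ)
    also have "inv_moment t = ennreal (\<rho> t)"
      unfolding \<rho>_def using fin by simp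
    finally have "ennreal (PZ t f x) \<le> ennreal (PZ t f y + \<rho> t * dist x y)"
      using nonneg by (simp add: ennreal_mult[symmetric] \<rho>_def mult.commute flip: ennreal_plus)
    then show ?thesis
      using nonneg by (subst (asm) ennreal_le_iff) (auto simp: \<rho>_def)
  qed
  show ?thesis using le[of x y] le[of y x] by (simp add: dist_commute abs_le_iff)
qed

end

section \<open>Consequences of the moment condition\<close>

locale subordinated_wiener_plus_levy_moment = subordinated_wiener_plus_levy +
  fixes \<delta> :: real
  assumes \<delta>: "0 < \<delta>" and moment: "(\<integral>\<^sup>+ s. indicator {0..\<delta>} s * inv_moment s \<partial>lborel) < \<infinity>"
begin

text \<open>An infinite value at \<open>s\<close> would by monotonicity be infinite on all of
  \<open>(0, s]\<close>, a set of positive length inside the range of integration near 0. Thus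
  finiteness holds also beyond \<delta>.\<close>

lemma inv_moment_finite:
  assumes "0 < s"
  shows "inv_moment s < \<infinity>"
proof (rule ccontr)
  assume "\<not> inv_moment s < \<infinity>"
  then have top: "inv_moment s = \<infinity>" by (simp add: less_top[symmetric])
  have "\<infinity> = (\<integral>\<^sup>+ r. \<infinity> * indicator {0<..min s \<delta>} r \<partial>lborel)"
    using \<open>0 < s\<close> \<delta> by (subst nn_integral_cmult_indicator) (auto simp: ennreal_top_mult min_def)
  also have "\<dots> \<le> (\<integral>\<^sup>+ r. indicator {0..\<delta>} r * inv_moment r \<partial>lborel)"
    by (intro nn_integral_mono)
      (use inv_moment_antimono[of _ s] top in \<open>auto simp: indicator_def top.extremum_unique\<close>)
  finally show False using moment by simp
qed

lemma \<rho>_nonneg: "0 \<le> \<rho> s"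
  by (simp add: \<rho>_def)

lemma \<rho>_antimono: "0 < s \<Longrightarrow> s \<le> t \<Longrightarrow> \<rho> t \<le> \<rho> s"
  unfolding \<rho>_def using inv_moment_finite[of s] by (intro enn2real_mono inv_moment_antimono) auto

lemma integrable_\<rho>: "integrable lborel (\<lambda>s. indicator {0<..\<delta>} s * \<rho> s)"
proof (rule integrableI_nonneg)
  \<comment> \<open>Measurability of \<rho> on the positive half-line comes from monotonicity; the
    sign is changed to obtain an increasing function and changed back below.\<close>
  have "mono_on {0<..} (\<lambda>s. - \<rho> s)" by (auto intro!: mono_onI \<rho>_antimono)
  then have "(\<lambda>s. - \<rho> s) \<in> borel_measurable (restrict_space borel {0<..})"
    by (rule borel_measurable_mono_on_fnc)
  then have "(\<lambda>s. indicator {0<..} s *\<^sub>R - \<rho> s) \<in> borel_measurable borel"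
    by (subst (asm) borel_measurable_restrict_space_iff) simp_all
  then have [measurable]: "(\<lambda>s. - (indicator {0<..} s *\<^sub>R - \<rho> s)) \<in> borel_measurable borel"
    by measurable
  have "(\<lambda>s. indicator {0<..\<delta>} s * - (indicator {0<..} s *\<^sub>R - \<rho> s)) \<in> borel_measurable borel"
    by measurable
  also have "(\<lambda>s. indicator {0<..\<delta>} s * - (indicator {0<..} s *\<^sub>R - \<rho> s)) = (\<lambda>s. indicator {0<..\<delta>} s * \<rho> s)"
    by (auto simp: fun_eq_iff indicator_def)
  finally show "(\<lambda>s. indicator {0<..\<delta>} s * \<rho> s) \<in> borel_measurable lborel" by simp
  have "(\<integral>\<^sup>+s. ennreal (indicator {0<..\<delta>} s * \<rho> s) \<partial>lborel) \<le> (\<integral>\<^sup>+ s. indicator {0..\<delta>} s * inv_moment s \<partial>lborel)"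
    by (intro nn_integral_mono) (use inv_moment_finite in \<open>auto simp: indicator_def \<rho>_def\<close>)
  then show "(\<integral>\<^sup>+s. ennreal (indicator {0<..\<delta>} s * \<rho> s) \<partial>lborel) < \<infinity>"
    using moment by (rule le_less_trans)
qed (simp add: \<rho>_nonneg)

definition I\<rho> :: "real \<Rightarrow> real" where "I\<rho> h = (\<integral>s. indicator {0<..h} s * \<rho> s \<partial>lborel)"

lemma integrable_\<rho>_le:
  assumes "h \<le> \<delta>"
  shows "integrable lborel (\<lambda>s. indicator {0<..h} s * \<rho> s)"
proof -
  have "integrable lborel (\<lambda>s. indicator {0<..h} s *\<^sub>R (indicator {0<..\<delta>} s * \<rho> s))"
    using integrable_\<rho> by (intro integrable_mult_indicator) auto
  also have "(\<lambda>s. indicator {0<..h} s *\<^sub>R (indicator {0<..\<delta>} s * \<rho> s)) = (\<lambda>s. indicator {0<..h} s * \<rho> s)"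
    using assms by (auto simp: fun_eq_iff indicator_def)
  finally show ?thesis .
qed

lemma I\<rho>_mono: "h \<le> h' \<Longrightarrow> h' \<le> \<delta> \<Longrightarrow> I\<rho> h \<le> I\<rho> h'"
  unfolding I\<rho>_def
  by (intro integral_mono integrable_\<rho>_le) (auto simp: indicator_def \<rho>_nonneg)

lemma I\<rho>_tendsto_0:
  assumes h: "h \<longlonglongrightarrow> 0" "\<And>n. h n \<le> \<delta>"
  shows "(\<lambda>n. I\<rho> (h n)) \<longlonglongrightarrow> 0"
proof -
  have "(\<lambda>n. I\<rho> (h n)) \<longlonglongrightarrow> (\<integral>s. 0 \<partial>(lborel :: real measure))"
    unfolding I\<rho>_def
  proof (rule integral_dominated_convergence[where w="\<lambda>s. indicator {0<..\<delta>} s * \<rho> s"])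
    show "(\<lambda>s. indicator {0<..h n} s * \<rho> s) \<in> borel_measurable lborel" for n
      using integrable_\<rho>_le[OF h(2)] by (rule borel_measurable_integrable)
    show "AE s in lborel. (\<lambda>n. indicator {0<..h n} s * \<rho> s) \<longlonglongrightarrow> 0"
    proof (rule AE_I2)
      fix s :: real
      show "(\<lambda>n. indicator {0<..h n} s * \<rho> s) \<longlonglongrightarrow> 0"
      proof (cases "s > 0")
        case True
        then have "eventually (\<lambda>n. h n < s) sequentially" using h(1) by (auto simp: order_tendsto_iff)
        then have "eventually (\<lambda>n. indicator {0<..h n} s * \<rho> s = 0) sequentially"
          by eventually_elim simp
        then show ?thesis by (rule tendsto_eventually)
      qed simp
    qed
    show "AE s in lborel. norm (indicator {0<..h n} s * \<rho> s) \<le> indicator {0<..\<delta>} s * \<rho> s" for n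
      using h(2)[of n] by (auto simp: indicator_def \<rho>_nonneg)
  qed (use integrable_\<rho> in auto)
  then show ?thesis by simp
qed

end

section \<open>Comparison of the two semigroups\<close>

lemma bounded_borelI: "f \<in> borel_measurable borel \<Longrightarrow> (\<And>x. \<bar>f x\<bar> \<le> B) \<Longrightarrow> bounded_borel f"
  by (auto simp: bounded_borel_def bounded_iff)

lemma bounded_borelD: "bounded_borel f \<Longrightarrow> f \<in> borel_measurable borel"
    "bounded_borel f \<Longrightarrow> \<exists>B. \<forall>x. \<bar>f x\<bar> \<le> B"
  by (auto simp: bounded_borel_def bounded_iff)

text \<open>Each starting point has its own probability space and its own driving noise
  \<open>Z' x\<close>, tied to \<open>Z\<close> only through its law.\<close>

locale markov_sde = subordinated_wiener_plus_levy_moment N W \<xi> T \<delta>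
  for N :: "'v measure" and W \<xi> :: "real \<Rightarrow> 'v \<Rightarrow> 'a::euclidean_space" and T \<delta> +
  fixes b :: "'a \<Rightarrow> 'a" and \<Omega> :: "'a \<Rightarrow> 'w measure" and X Z' :: "'a \<Rightarrow> real \<Rightarrow> 'w \<Rightarrow> 'a"
  assumes sol: "\<And>x. weak_solution b N Z x (\<Omega> x) (X x) (Z' x)"
    and markov: "markov_family \<Omega> X"
    and b: "bounded (range b)"
begin

section \<open>Short-time comparison and the Markov property\<close>

abbreviation PX :: "real \<Rightarrow> ('a \<Rightarrow> real) \<Rightarrow> 'a \<Rightarrow> real" where "PX \<equiv> transition \<Omega> X"

definition \<beta> :: real where "\<beta> = (SUP x. norm (b x))"

lemma norm_b_le: "norm (b x) \<le> \<beta>"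
proof -
  have "bdd_above (range (\<lambda>x. norm (b x)))"
    using b unfolding bounded_iff bdd_above_def by auto
  then show ?thesis unfolding \<beta>_def by (rule cSUP_upper[OF UNIV_I])
qed

lemma \<beta>_nonneg: "0 \<le> \<beta>"
  using norm_b_le[of 0] norm_ge_zero order_trans by blast

lemma prob_space_\<Omega>: "prob_space (\<Omega> x)"
  using sol by (simp add: weak_solution_def)

lemma X_measurable: "0 \<le> t \<Longrightarrow> X x t \<in> borel_measurable (\<Omega> x)"
  using sol by (simp add: weak_solution_def)

lemma Z'_measurable: "0 \<le> t \<Longrightarrow> Z' x t \<in> borel_measurable (\<Omega> x)"
  using sol by (simp add: weak_solution_def)

lemma distr_Z':
  assumes t: "0 \<le> t"
  shows "distr (\<Omega> x) borel (Z' x t) = distr N borel (Z t)"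
proof -
  have "distr (process_law M V) borel (\<lambda>w. w t) = distr M borel (V t)"
    if "\<And>s. 0 \<le> s \<Longrightarrow> V s \<in> borel_measurable M" for M :: "'m measure" and V :: "real \<Rightarrow> 'm \<Rightarrow> 'a"
  proof -
    have "(\<lambda>\<omega>. restrict (\<lambda>t. V t \<omega>) {0..}) \<in> measurable M (PiM {0..} (\<lambda>_. borel))"
      using that by (intro measurable_restrict) auto
    then show ?thesis
      unfolding process_law_def using t
      by (subst distr_distr) (auto simp: o_def intro!: measurable_component_singleton)
  qed
  from this[of "Z' x" "\<Omega> x"] this[of Z N] show ?thesis
    using sol[of x] Z'_measurable Z_measurable by (simp add: weak_solution_def)
qed

text \<open>A coupling on \<open>\<Omega> x\<close>: \<open>x + Z' x d\<close> has the law that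
  defines \<open>PZ\<close>, and it differs from the solution by the drift integral, of norm at most
  \<open>\<beta> * d\<close>.\<close>

lemma PX_PZ_diff_le_lipschitz:
  assumes d: "0 < d" and k: "0 \<le> k" and lip: "\<And>x y. \<bar>g x - g y\<bar> \<le> k * dist x y"
    and g: "\<And>x. 0 \<le> g x" "\<And>x. g x \<le> 1" and [measurable]: "g \<in> borel_measurable borel"
  shows "\<bar>PX d g x - PZ d g x\<bar> \<le> k * (\<beta> * d)"
proof -
  interpret P: prob_space "\<Omega> x" by (rule prob_space_\<Omega>)
  have [measurable]: "X x d \<in> borel_measurable (\<Omega> x)" "Z' x d \<in> borel_measurable (\<Omega> x)" "Z d \<in> borel_measurable N"
    using d by (auto intro: X_measurable Z'_measurable Z_measurable)
  have "PZ d g x = (\<integral>z. g (x + z) \<partial>distr N borel (Z d))"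
    unfolding PZ_def by (simp add: integral_distr)
  also have "\<dots> = (\<integral>\<omega>. g (x + Z' x d \<omega>) \<partial>\<Omega> x)"
    using d by (simp add: distr_Z'[symmetric, of d x] integral_distr)
  finally have PZ: "PZ d g x = (\<integral>\<omega>. g (x + Z' x d \<omega>) \<partial>\<Omega> x)" .
  have i: "integrable (\<Omega> x) (\<lambda>\<omega>. g (X x d \<omega>))" "integrable (\<Omega> x) (\<lambda>\<omega>. g (x + Z' x d \<omega>))"
    by (auto intro!: P.integrable_const_bound[where B=1] simp: g)
  have "AE \<omega> in \<Omega> x. set_integrable lborel {0..d} (\<lambda>s. b (X x s \<omega>))
                       \<and> X x d \<omega> = x + (LINT s:{0..d}|lborel. b (X x s \<omega>)) + Z' x d \<omega>"
    using sol[of x] d unfolding weak_solution_def by (auto elim: eventually_mono)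
  then have AE: "AE \<omega> in \<Omega> x. \<bar>g (X x d \<omega>) - g (x + Z' x d \<omega>)\<bar> \<le> k * (\<beta> * d)"
  proof eventually_elim
    case (elim \<omega>)
    let ?A = "LINT s:{0..d}|lborel. b (X x s \<omega>)"
    have "norm ?A \<le> (\<integral>s. norm (indicator {0..d} s *\<^sub>R b (X x s \<omega>)) \<partial>lborel)"
      unfolding set_lebesgue_integral_def by (rule integral_norm_bound)
    also have "\<dots> \<le> (\<integral>s. indicator {0..d} s * \<beta> \<partial>lborel)"
    proof (rule integral_mono)
      show "integrable lborel (\<lambda>s. norm (indicator {0..d} s *\<^sub>R b (X x s \<omega>)))"
        by (rule integrable_norm) (use elim in \<open>simp add: set_integrable_def\<close>)
      show "integrable lborel (\<lambda>s. indicator {0..d} s * \<beta>)"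
        using d by (intro integrable_mult_left integrable_real_indicator) auto
    qed (auto simp: indicator_def norm_b_le)
    also have "\<dots> = \<beta> * d" using d by simp
    finally have A: "norm ?A \<le> \<beta> * d" .
    have "dist (X x d \<omega>) (x + Z' x d \<omega>) = norm ?A" using elim by (simp add: dist_norm)
    then have "\<bar>g (X x d \<omega>) - g (x + Z' x d \<omega>)\<bar> \<le> k * norm ?A"
      using lip[of "X x d \<omega>" "x + Z' x d \<omega>"] by simp
    also have "\<dots> \<le> k * (\<beta> * d)" using A k by (rule mult_left_mono)
    finally show ?case .
  qed
  have "PX d g x - PZ d g x = (\<integral>\<omega>. g (X x d \<omega>) - g (x + Z' x d \<omega>) \<partial>\<Omega> x)"
    unfolding PZ transition_def using i by simp
  also have "\<bar>\<dots>\<bar> \<le> (\<integral>\<omega>. \<bar>g (X x d \<omega>) - g (x + Z' x d \<omega>)\<bar> \<partial>\<Omega> x)"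
    by (rule integral_abs_bound)
  also have "\<dots> \<le> (\<integral>\<omega>. k * (\<beta> * d) \<partial>\<Omega> x)"
    using i AE by (intro integral_mono_AE) auto
  finally show ?thesis by (simp add: P.prob_space)
qed

text \<open>This form of the Markov property requires no measurability of \<open>PX t f\<close> itself, which is
  not known a priori for Borel \<open>f\<close>.\<close>

lemma PX_add_approx:
  assumes s: "0 \<le> s" and t: "0 \<le> t" and f: "bounded_borel f" and \<phi>: "bounded_borel \<phi>"
    and le: "\<And>y. \<bar>PX t f y - \<phi> y\<bar> \<le> \<epsilon>"
  shows "\<bar>PX (s + t) f x - PX s \<phi> x\<bar> \<le> \<epsilon>"
proof -
  interpret P: prob_space "\<Omega> x" by (rule prob_space_\<Omega>)
  note [measurable] = bounded_borelD(1)[OF f] bounded_borelD(1)[OF \<phi>]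
  have [measurable]: "X x (s + t) \<in> borel_measurable (\<Omega> x)" "X x s \<in> borel_measurable (\<Omega> x)"
    using s t by (auto intro: X_measurable)
  let ?F = "natural_filtration (\<Omega> x) (X x) s"
  have "{X x r -` A \<inter> space (\<Omega> x) | r A. 0 \<le> r \<and> r \<le> s \<and> A \<in> sets borel} \<subseteq> sets (\<Omega> x)"
    by (safe intro!: measurable_sets[OF X_measurable])
  then have "subalgebra (\<Omega> x) ?F"
    unfolding subalgebra_def natural_filtration_def
    by (simp add: space_measure_of_conv sets_measure_of_conv sets.sigma_sets_subset)
  then interpret F: finite_measure_subalgebra "\<Omega> x" ?F
    by unfold_locales
  let ?E = "real_cond_exp (\<Omega> x) ?F (\<lambda>\<omega>. f (X x (s + t) \<omega>))"
  obtain B where B: "\<And>x. \<bar>f x\<bar> \<le> B" using bounded_borelD(2)[OF f] by blast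
  obtain C where C: "\<And>x. \<bar>\<phi> x\<bar> \<le> C" using bounded_borelD(2)[OF \<phi>] by blast
  have i: "integrable (\<Omega> x) (\<lambda>\<omega>. f (X x (s + t) \<omega>))"
    by (rule P.integrable_const_bound[where B=B]) (auto simp: B)
  have i\<phi>: "integrable (\<Omega> x) (\<lambda>\<omega>. \<phi> (X x s \<omega>))"
    by (rule P.integrable_const_bound[where B=C]) (auto simp: C)
  note E = F.real_cond_exp_int[OF i]
  have "AE \<omega> in \<Omega> x. ?E \<omega> = PX t f (X x s \<omega>)"
    using markov s t f unfolding markov_family_def by blast
  then have AE: "AE \<omega> in \<Omega> x. \<bar>?E \<omega> - \<phi> (X x s \<omega>)\<bar> \<le> \<epsilon>"
    by eventually_elim (simp add: le)
  \<comment> \<open>Conditional expectation preserves the integral, so \<open>?E\<close> stands in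
    for \<open>f (X x (s + t) \<omega>)\<close>; the function \<open>PX t f\<close> enters only
    pointwise, through \<open>AE\<close>.\<close>
  have "PX (s + t) f x - PX s \<phi> x = (\<integral>\<omega>. ?E \<omega> - \<phi> (X x s \<omega>) \<partial>\<Omega> x)"
    unfolding transition_def using E i\<phi> by simp
  also have "\<bar>\<dots>\<bar> \<le> (\<integral>\<omega>. \<bar>?E \<omega> - \<phi> (X x s \<omega>)\<bar> \<partial>\<Omega> x)"
    by (rule integral_abs_bound)
  also have "\<dots> \<le> (\<integral>\<omega>. \<epsilon> \<partial>\<Omega> x)"
    using E i\<phi> AE by (intro integral_mono_AE) auto
  finally show ?thesis by (simp add: P.prob_space)
qed

text \<open>Telescoping over the two semigroups. Only the innermost increment sees the Lipschitz constant
  \<open>k\<close> of \<open>g\<close>, so \<open>k\<close> disappears as the mesh \<open>d\<close> tends to zero.\<close>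

lemma PX_PZ_diff_le_sum:
  assumes d: "0 < d" and k: "0 \<le> k" and lip: "\<And>x y. \<bar>g x - g y\<bar> \<le> k * dist x y"
    and g: "\<And>x. 0 \<le> g x" "\<And>x. g x \<le> 1" and [measurable]: "g \<in> borel_measurable borel"
  shows "\<bar>PX (real (Suc m) * d) g x - PZ (real (Suc m) * d) g x\<bar>
    \<le> k * (\<beta> * d) + \<beta> * (d * (\<Sum>j<m. \<rho> (real (Suc j) * d)))"
proof (induction m arbitrary: x)
  case 0
  show ?case using PX_PZ_diff_le_lipschitz[OF assms] by simp
next
  case (Suc m)
  define t where "t = real (Suc m) * d"
  have t: "0 < t" using d by (simp add: t_def)
  have eq: "real (Suc (Suc m)) * d = d + t" by (simp add: t_def algebra_simps)
  have [measurable]: "PZ t g \<in> borel_measurable borel" using t by (intro PZ_measurable) auto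
  have P01: "0 \<le> PZ t g x" "PZ t g x \<le> 1" for x using g t by (auto intro!: PZ_bounds)
  have bb: "bounded_borel g" by (rule bounded_borelI[where B=1]) (auto simp: g abs_le_iff intro: order_trans[OF _ g(1)])
  have bP: "bounded_borel (PZ t g)"
    by (rule bounded_borelI[where B=1]) (auto simp: P01 abs_le_iff intro: order_trans[OF _ P01(1)])
  \<comment> \<open>The induction hypothesis is uniform in the starting point, so the Markov
    property propagates it over the first step without loss.\<close>
  have "\<bar>PX (d + t) g x - PX d (PZ t g) x\<bar> \<le> k * (\<beta> * d) + \<beta> * (d * (\<Sum>j<m. \<rho> (real (Suc j) * d)))"
    using d t bb bP Suc.IH unfolding t_def[symmetric] by (intro PX_add_approx) auto
  \<comment> \<open>The one-step bound is applied to \<open>PZ t g\<close> with its own Lipschitz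
    constant \<open>\<rho> t\<close>; this produces the new summand \<open>j = m\<close>.\<close>
  moreover have "\<bar>PX d (PZ t g) x - PZ d (PZ t g) x\<bar> \<le> \<rho> t * (\<beta> * d)"
    using d g t by (intro PX_PZ_diff_le_lipschitz PZ_lipschitz inv_moment_finite P01 \<rho>_nonneg) auto
  moreover have "PZ d (PZ t g) x = PZ (d + t) g x"
    using g d t by (intro PZ_add[symmetric]) auto
  ultimately have "\<bar>PX (d + t) g x - PZ (d + t) g x\<bar>
    \<le> k * (\<beta> * d) + \<beta> * (d * (\<Sum>j<m. \<rho> (real (Suc j) * d))) + \<rho> t * (\<beta> * d)" by linarith
  also have "\<dots> = k * (\<beta> * d) + \<beta> * (d * (\<Sum>j<Suc m. \<rho> (real (Suc j) * d)))"
    by (simp add: t_def algebra_simps)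
  finally show ?case unfolding eq .
qed

text \<open>With mesh \<open>h / (m + 1)\<close> the sum of the smoothing constants stays below the
  integral of \<rho>, while the term with \<open>k\<close> is of the order of the mesh and vanishes
  in the limit.\<close>

lemma PX_PZ_diff_le_integral:
  assumes h: "0 < h" "h \<le> \<delta>" and k: "0 \<le> k" and lip: "\<And>x y. \<bar>g x - g y\<bar> \<le> k * dist x y"
    and g: "\<And>x. 0 \<le> g x" "\<And>x. g x \<le> 1" and [measurable]: "g \<in> borel_measurable borel"
  shows "\<bar>PX h g x - PZ h g x\<bar> \<le> \<beta> * I\<rho> h"
proof -
  have "\<bar>PX h g x - PZ h g x\<bar> \<le> k * (\<beta> * (h * inverse (real (Suc m)))) + \<beta> * I\<rho> h" for m
  proof -
    define d where "d = h * inverse (real (Suc m))"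
    have d: "0 < d" "real (Suc m) * d = h" using h by (auto simp: d_def)
    have le: "real m * d \<le> h" using d by (simp add: algebra_simps)
    have "d * (\<Sum>j<m. \<rho> (real (Suc j) * d)) \<le> I\<rho> (real m * d)"
      unfolding I\<rho>_def using integrable_\<rho> le h d by (intro sum_le_integral_antimono[of \<delta>] \<rho>_antimono) auto
    also have "\<dots> \<le> I\<rho> h" using le h by (intro I\<rho>_mono) auto
    finally have "\<beta> * (d * (\<Sum>j<m. \<rho> (real (Suc j) * d))) \<le> \<beta> * I\<rho> h"
      using \<beta>_nonneg by (rule mult_left_mono)
    then show ?thesis
      using PX_PZ_diff_le_sum[OF d(1) k lip g, of m x] unfolding d(2) d_def[symmetric] by simp
  qed
  moreover have "(\<lambda>m. k * (\<beta> * (h * inverse (real (Suc m)))) + \<beta> * I\<rho> h) \<longlonglongrightarrow> k * (\<beta> * (h * 0)) + \<beta> * I\<rho> h"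
    by (intro tendsto_intros LIMSEQ_inverse_real_of_nat)
  ultimately show ?thesis
    by (intro LIMSEQ_le_const[where X="\<lambda>m. k * (\<beta> * (h * inverse (real (Suc m)))) + \<beta> * I\<rho> h"]) auto
qed

text \<open>The preceding bound is free of \<open>k\<close>, so it passes from Lipschitz functions
  to Borel sets and from there to Borel functions, for the laws of \<open>X x h\<close> and
  \<open>x + Z h\<close>.\<close>

lemma PX_PZ_diff_le_borel:
  assumes h: "0 < h" "h \<le> \<delta>" and [measurable]: "f \<in> borel_measurable borel"
    and f: "\<And>x. 0 \<le> f x" "\<And>x. f x < 1"
  shows "\<bar>PX h f x - PZ h f x\<bar> \<le> \<beta> * I\<rho> h"
proof -
  interpret P: prob_space "\<Omega> x" by (rule prob_space_\<Omega>)
  have [measurable]: "X x h \<in> borel_measurable (\<Omega> x)" "Z h \<in> borel_measurable N"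
    using h by (auto intro: X_measurable Z_measurable)
  let ?M = "distr (\<Omega> x) borel (X x h)" and ?N = "distr N borel (\<lambda>\<omega>. x + Z h \<omega>)"
  have PX: "(\<integral>y. g y \<partial>?M) = PX h g x" if [measurable]: "g \<in> borel_measurable borel" for g
    unfolding transition_def by (simp add: integral_distr)
  have PZ: "(\<integral>y. g y \<partial>?N) = PZ h g x" if [measurable]: "g \<in> borel_measurable borel" for g
    unfolding PZ_def by (simp add: integral_distr)
  have pM: "prob_space ?M" by (rule P.prob_space_distr) simp
  have pN: "prob_space ?N" by (rule prob_space_distr) simp
  have "\<bar>measure ?M B - measure ?N B\<bar> \<le> \<beta> * I\<rho> h" if "B \<in> sets borel" for B
  proof (rule measure_diff_le_of_lipschitz[OF pM pN _ _ _ that])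
    fix g :: "'a \<Rightarrow> real" and k
    assume g: "0 \<le> k" "\<And>x y. \<bar>g x - g y\<bar> \<le> k * dist x y" "\<And>x. 0 \<le> g x" "\<And>x. g x \<le> 1"
    have "k-lipschitz_on UNIV g" using g by (intro lipschitz_onI) (auto simp: dist_real_def)
    then have [measurable]: "g \<in> borel_measurable borel"
      by (intro borel_measurable_continuous_onI lipschitz_on_continuous_on)
    show "\<bar>(\<integral>x. g x \<partial>?M) - (\<integral>x. g x \<partial>?N)\<bar> \<le> \<beta> * I\<rho> h"
      using PX_PZ_diff_le_integral[OF h g] by (simp add: PX PZ)
  qed simp_all
  then show ?thesis
    using integral_diff_le_of_measure[OF pM pN, of "\<beta> * I\<rho> h" f] f by (simp add: PX PZ)
qed

lemma PX_strong_feller: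
  assumes feller: "\<And>t. t \<ge> 0 \<Longrightarrow> feller_op (PX t)" and t: "0 < t"
  shows "strong_feller_op (PX t)"
  unfolding strong_feller_op_def
proof (intro allI impI)
  fix f :: "'a \<Rightarrow> real" assume bf: "bounded_borel f"
  note [measurable] = bounded_borelD(1)[OF bf]
  obtain B0 where B0: "\<And>x. \<bar>f x\<bar> \<le> B0" using bounded_borelD(2)[OF bf] by blast
  \<comment> \<open>The extra one makes \<open>B\<close> positive and the bound strict, so the
    affine rescaling \<open>u\<close> takes values below one.\<close>
  define B where "B = \<bar>B0\<bar> + 1"
  have B: "B > 0" "\<bar>f x\<bar> < B" for x using B0[of x] by (auto simp: B_def)
  define u where "u x = (f x + B) / (2 * B)" for x
  have [measurable]: "u \<in> borel_measurable borel" unfolding u_def by measurable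
  have u: "0 \<le> u x" "u x < 1" for x using B(1) B(2)[of x] by (auto simp: u_def)
  have u1: "u x \<le> 1" for x using u(2) less_imp_le by blast
  have fu: "f x = 2 * B * u x - B" for x using B by (simp add: u_def)
  have PXu: "PX s f x = 2 * B * PX s u x - B" if "0 \<le> s" for s x
  proof -
    interpret P: prob_space "\<Omega> x" by (rule prob_space_\<Omega>)
    have [measurable]: "X x s \<in> borel_measurable (\<Omega> x)" using that by (rule X_measurable)
    have "integrable (\<Omega> x) (\<lambda>\<omega>. u (X x s \<omega>))"
      by (rule P.integrable_const_bound[where B=1]) (auto simp: u u1)
    then show ?thesis unfolding transition_def fu by (simp add: P.prob_space)
  qed
  have PZu: "PZ s f x = 2 * B * PZ s u x - B" if "0 \<le> s" for s x
  proof -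
    have [measurable]: "Z s \<in> borel_measurable N" using that by (rule Z_measurable)
    have "integrable N (\<lambda>\<omega>. u (x + Z s \<omega>))"
      by (rule integrable_const_bound[where B=1]) (auto simp: u u1)
    then show ?thesis unfolding PZ_def fu by (simp add: prob_space)
  qed
  have bcont: "bounded_continuous (PZ h f)" if "0 < h" for h
  proof -
    have "(\<rho> h)-lipschitz_on UNIV (PZ h u)"
      using that u u1 by (intro lipschitz_onI) (auto simp: dist_real_def intro!: PZ_lipschitz inv_moment_finite \<rho>_nonneg)
    then have "continuous_on UNIV (PZ h u)" by (rule lipschitz_on_continuous_on)
    then have "continuous_on UNIV (\<lambda>x. 2 * B * PZ h u x - B)" by (intro continuous_intros)
    moreover have "bounded (range (\<lambda>x. 2 * B * PZ h u x - B))"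
    proof (rule boundedI)
      fix y assume "y \<in> range (\<lambda>x. 2 * B * PZ h u x - B)"
      then obtain x where y: "y = 2 * B * PZ h u x - B" by blast
      have "0 \<le> PZ h u x" "PZ h u x \<le> 1" using that u u1 by (auto intro!: PZ_bounds)
      then have "0 \<le> 2 * B * PZ h u x" "2 * B * PZ h u x \<le> 2 * B * 1"
        using B(1) by (auto intro!: mult_left_mono)
      then show "norm y \<le> B" unfolding y by (simp add: abs_le_iff)
    qed
    ultimately show ?thesis
      using that unfolding bounded_continuous_def by (simp add: PZu)
  qed
  \<comment> \<open>Keeps \<open>h n\<close> positive and within \<delta>, where the comparison
    holds, and at most \<open>t\<close>, so that \<open>t - h n\<close> is an admissible time,
    possibly 0.\<close>
  define h where "h n = min \<delta> t * inverse (real (Suc n))" for n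
  have h: "0 < h n" "h n \<le> \<delta>" "h n \<le> t" for n
  proof -
    have "min \<delta> t * inverse (real (Suc n)) \<le> min \<delta> t * 1"
      using \<delta> t by (intro mult_left_mono) (auto simp: inverse_le_1_iff)
    then show "0 < h n" "h n \<le> \<delta>" "h n \<le> t" using \<delta> t by (auto simp: h_def)
  qed
  have h0: "h \<longlonglongrightarrow> 0"
    unfolding h_def using tendsto_mult[OF tendsto_const LIMSEQ_inverse_real_of_nat, of "min \<delta> t"] by simp
  \<comment> \<open>The short-time error between the semigroups is uniform in the starting point;
    running \<open>PX\<close> for the remaining time \<open>t - h n\<close> cannot enlarge
    it.\<close>
  have approx: "\<bar>PX t f x - PX (t - h n) (PZ (h n) f) x\<bar> \<le> 2 * B * (\<beta> * I\<rho> (h n))" for x n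
  proof -
    have "bounded_borel (PZ (h n) f)"
      using bcont[OF h(1)] by (auto simp: bounded_continuous_def bounded_borel_def intro: borel_measurable_continuous_onI)
    moreover have "\<bar>PX (h n) f y - PZ (h n) f y\<bar> \<le> 2 * B * (\<beta> * I\<rho> (h n))" for y
    proof -
      have "\<bar>PX (h n) f y - PZ (h n) f y\<bar> = 2 * B * \<bar>PX (h n) u y - PZ (h n) u y\<bar>"
        using h(1)[of n] B(1) by (simp add: PXu PZu abs_mult flip: right_diff_distrib)
      also have "\<dots> \<le> 2 * B * (\<beta> * I\<rho> (h n))"
        using B(1) h u by (intro mult_left_mono PX_PZ_diff_le_borel) auto
      finally show ?thesis .
    qed
    ultimately show ?thesis
      using PX_add_approx[of "t - h n" "h n" f "PZ (h n) f" _ x] h bf by (simp add: less_imp_le)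
  qed
  have lim0: "(\<lambda>n. 2 * B * (\<beta> * I\<rho> (h n))) \<longlonglongrightarrow> 2 * B * (\<beta> * 0)"
    by (intro tendsto_intros I\<rho>_tendsto_0 h0 h)
  have unif: "uniform_limit UNIV (\<lambda>n. PX (t - h n) (PZ (h n) f)) (PX t f) sequentially"
  proof (rule uniform_limitI)
    fix e :: real assume "e > 0"
    then have "eventually (\<lambda>n. 2 * B * (\<beta> * I\<rho> (h n)) < e) sequentially"
      using lim0 by (auto simp: order_tendsto_iff)
    then show "eventually (\<lambda>n. \<forall>x\<in>UNIV. dist (PX (t - h n) (PZ (h n) f) x) (PX t f x) < e) sequentially"
    proof eventually_elim
      case (elim n)
      show ?case
      proof
        fix x
        show "dist (PX (t - h n) (PZ (h n) f) x) (PX t f x) < e"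
          using approx[of x n] elim by (simp add: dist_real_def abs_minus_commute)
      qed
    qed
  qed
  \<comment> \<open>The noise has already made \<open>PZ (h n) f\<close> bounded and continuous, so
    the Feller property suffices here.\<close>
  have "continuous_on UNIV (PX (t - h n) (PZ (h n) f))" for n
    using feller[of "t - h n"] h[of n] bcont[OF h(1)[of n]] by (auto simp: feller_op_def bounded_continuous_def)
  then have "continuous_on UNIV (PX t f)"
    by (intro uniform_limit_theorem[OF _ unif]) auto
  moreover have "bounded (range (PX t f))"
  proof (rule boundedI)
    fix y assume "y \<in> range (PX t f)"
    then obtain x where y: "y = PX t f x" by blast
    interpret P: prob_space "\<Omega> x" by (rule prob_space_\<Omega>)
    have [measurable]: "X x t \<in> borel_measurable (\<Omega> x)" using t by (intro X_measurable) auto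
    have i: "integrable (\<Omega> x) (\<lambda>\<omega>. f (X x t \<omega>))"
      by (rule P.integrable_const_bound[where B=B0]) (auto simp: B0)
    have "\<bar>y\<bar> \<le> (\<integral>\<omega>. \<bar>f (X x t \<omega>)\<bar> \<partial>\<Omega> x)"
      unfolding y transition_def by (rule integral_abs_bound)
    also have "\<dots> \<le> (\<integral>\<omega>. B0 \<partial>\<Omega> x)" using i by (intro integral_mono B0) auto
    finally show "norm y \<le> B0" by (simp add: P.prob_space)
  qed
  ultimately show "bounded_continuous (PX t f)" by (simp add: bounded_continuous_def)
qed

end

theorem theorem4p3:
  fixes N :: "'v measure"
    and W :: "real \<Rightarrow> 'v \<Rightarrow> 'a::euclidean_space"
    and T :: "real \<Rightarrow> 'v \<Rightarrow> real"
    and \<xi> :: "real \<Rightarrow> 'v \<Rightarrow> 'a"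
    and b :: "'a \<Rightarrow> 'a"
    and \<Omega> :: "'a \<Rightarrow> 'w measure"
    and X Z' :: "'a \<Rightarrow> real \<Rightarrow> 'w \<Rightarrow> 'a"
  defines "Y \<equiv> (\<lambda>t \<omega>. W (T t \<omega>) \<omega>)"
  defines "Z \<equiv> (\<lambda>t \<omega>. Y t \<omega> + \<xi> t \<omega>)"
  assumes W: "wiener_process N W"
    and T: "subordinator N T"
    and indep_WT: "indep_processes N W T"
    and \<xi>: "levy_process N \<xi>"
    and indep_Y\<xi>: "indep_processes N Y \<xi>"
    and sol: "\<And>x. weak_solution b N Z x (\<Omega> x) (X x) (Z' x)"
    and markov: "markov_family \<Omega> X"
    and feller: "\<And>t. t \<ge> 0 \<Longrightarrow> feller_op (transition \<Omega> X t)"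
    and moment: "\<exists>\<delta>>0. (\<integral>\<^sup>+ s. indicator {0..\<delta>} s * (\<integral>\<^sup>+ \<omega>. ennreal (1 / sqrt (T s \<omega>)) \<partial>N) \<partial>lborel) < \<infinity>"
    and b: "bounded_continuous b"
  shows "\<forall>t>0. strong_feller_op (transition \<Omega> X t)"
proof -
  interpret S: subordinated_wiener_plus_levy N W \<xi> T
    using W T indep_WT \<xi> indep_Y\<xi> unfolding Y_def by unfold_locales
  obtain \<delta> where "\<delta> > 0" "(\<integral>\<^sup>+ s. indicator {0..\<delta>} s * S.inv_moment s \<partial>lborel) < \<infinity>"
    using moment unfolding S.inv_moment_def by blast
  \<comment> \<open>Identifies the noise of the locale with that of the theorem, so that
    \<open>sol\<close> discharges the corresponding locale assumption.\<close>
  moreover have "S.Z = Z"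
    by (simp add: fun_eq_iff S.Z_def S.Y_def Z_def Y_def)
  ultimately interpret markov_sde N W \<xi> T \<delta> b \<Omega> X Z'
    using sol markov b by unfold_locales (auto simp: bounded_continuous_def)
  show ?thesis using PX_strong_feller feller by blast
qed

end
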